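(* Let $(M,\mathcal T,I)$ be a triangulated connected closed surface with inversive distance $I\ge 0$. Assume there exists a metric of constant curvature $r^*\in\Omega$. Let $r(t)$ be the solution of the normalized flow $$r_i'(t)=(K_{av}-K_i)\,r_i,\quad i\in V,\qquad r(0)\in\Omega .$$ Then $r(t)$ can always be extended to a solution (of the extended flow, defined for all $t\ge0$) that converges exponentially fast to a metric of constant curvature as $t\to+\infty$. That is, writing $u_i=\ln r_i$, the solution to the extended flow $$u_i'(t)=K_{av}-\widetilde K_i,\quad i\in V,\qquad u(0)\in\ln\Omega,$$ converges exponentially fast to a metric of constant curvature as $t\to+\infty$.
   Context: $M$ is a connected closed surface with triangulation $\mathcal T=\{V,E,F\}$ (vertices, edges, faces), $V=\{1,\dots,N\}$; $\{ij\}$ denotes the edge joining $i,j$ and $\{ijk\}$ the face with vertices $i,j,k$. The inversive distance is a fixed function $I:E\to[0,+\infty)$. For $r\in\mathbb R^N_{>0}$ put $l_{ij}=\sqrt{r_i^2+r_j^2+2r_ir_jI_{ij}}$ for each edge. $\Omega\subset\mathbb R^N_{>0}$ is the set of $r$ such that for every face $\{ijk\}$ the three numbers $l_{ij},l_{jk},l_{ik}$ satisfy the three strict triangle inequalities. $\ln\Omega=\{x\in\mathbb R^N: (e^{x_1},\dots,e^{x_N})\in\Omega\}$. A metric $r\in\Omega$ is identified with its logarithm $u\in\ln\Omega$, $u_i=\ln r_i$. For $r\in\Omega$, $\theta_i^{jk}$ is the inner angle at $i$ of the Euclidean triangle with edge lengths $l_{ij},l_{jk},l_{ik}$, and $K_i=2\pi-\sum_{\{ijk\}\in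 F}\theta_i^{jk}$ (sum over faces containing $i$). $K_{av}=2\pi\chi(M)/N$. A metric of constant curvature is an $r\in\Omega$ with $K_i(r)=K_{av}$ for all $i\in V$. For arbitrary $r\in\mathbb R^N_{>0}$ and a face $\{ijk\}$, the generalized angles are defined by: if the strict triangle inequalities hold, $\tilde\theta_i^{jk}=\theta_i^{jk}$ (and similarly for $j,k$); if $l_{jk}\ge l_{ij}+l_{ik}$, then $\tilde\theta_i^{jk}=\pi$ and $\tilde\theta_j^{ik}=\tilde\theta_k^{ij}=0$ (and similarly with the roles of $i,j,k$ permuted). The extended curvature is $\widetilde K_i=2\pi-\sum_{\{ijk\}\in F}\tilde\theta_i^{jk}$, a continuous function on $\mathbb R^N_{>0}$ extending $K_i$; as a function of $u$ it is evaluated at $r=(e^{u_1},\dots,e^{u_N})$. Exponentially fast convergence of $u(t)$ to $u^*$ means $\|u(t)-u^*\|\le Ce^{-ct}$ for all $t\ge0$, for some constants $C,c>0$. *)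

theory Defs
  imports "HOL-Analysis.Analysis"
begin

section \<open>Triangulated closed surfaces\<close>

text \<open>A closed surface is a compact topological 2-manifold without boundary;
  connectedness is a separate hypothesis.\<close>

definition closed_surface :: "'a topology \<Rightarrow> bool" where
  "closed_surface M \<longleftrightarrow>
     compact_space M \<and> Hausdorff_space M \<and> second_countable M \<and>
     (\<forall>x\<in>topspace M. \<exists>U W. openin M U \<and> x \<in> U \<and> open (W :: (real^2) set) \<and>
        subtopology M U homeomorphic_space top_of_set W)"

text \<open>The vertex set is the whole finite type \<open>'v\<close>; an edge joining i and j is the set
  \<open>{i,j}\<close>, a face with vertices i, j, k is the set \<open>{i,j,k}\<close>.
  The geometric realization is given in barycentric coordinates.\<close>

definition geometric_realization :: "'v::finite set set \<Rightarrow> 'v set set \<Rightarrow> (real^'v) set" where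
  "geometric_realization E F =
     {x. (\<forall>i. 0 \<le> x $ i) \<and> (\<Sum>i\<in>UNIV. x $ i) = 1 \<and>
         {i. x $ i \<noteq> 0} \<in> range (\<lambda>i. {i}) \<union> E \<union> F}"

text \<open>The third to fifth conditions say that the simplices form a pure two-dimensional
  simplicial complex, as is automatic for a triangulation of a surface.\<close>

definition surface_triangulation :: "'a topology \<Rightarrow> 'v::finite set set \<Rightarrow> 'v set set \<Rightarrow> bool" where
  "surface_triangulation M E F \<longleftrightarrow>
     (\<forall>e\<in>E. card e = 2) \<and>
     (\<forall>f\<in>F. card f = 3) \<and>
     (\<forall>f\<in>F. \<forall>e. e \<subseteq> f \<and> card e = 2 \<longrightarrow> e \<in> E) \<and>
     (\<forall>e\<in>E. \<exists>f\<in>F. e \<subseteq> f) \<and>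
     (\<forall>i. \<exists>e\<in>E. i \<in> e) \<and>
     M homeomorphic_space top_of_set (geometric_realization E F)"

definition euler_char :: "'v::finite set set \<Rightarrow> 'v set set \<Rightarrow> int" where
  "euler_char E F = int CARD('v) - int (card E) + int (card F)"

section \<open>Angles of Euclidean triangles\<close>

definition strict_triangle :: "real \<Rightarrow> real \<Rightarrow> real \<Rightarrow> bool" where
  "strict_triangle a b c \<longleftrightarrow> a < b + c \<and> b < a + c \<and> c < a + b"

definition vec_angle :: "real^2 \<Rightarrow> real^2 \<Rightarrow> real" where
  "vec_angle v w = arccos (v \<bullet> w / (norm v * norm w))"

text \<open>\<open>triangle_angle a b c\<close> is the inner angle opposite to the side of length a in
  a Euclidean triangle with side lengths a, b, c. It is well defined because all such
  triangles are congruent.\<close>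

definition triangle_angle :: "real \<Rightarrow> real \<Rightarrow> real \<Rightarrow> real" where
  "triangle_angle a b c =
     (THE \<alpha>. \<exists>A B C. dist B C = a \<and> dist A C = b \<and> dist A B = c \<and>
               \<alpha> = vec_angle (B - A) (C - A))"

lemma triangle_exists:
  assumes "0 < a" "0 < b" "0 < c" "strict_triangle a b c"
  obtains A B C :: "real^2" where "dist B C = a" "dist A C = b" "dist A B = c"
proof -
  define x where "x = (b\<^sup>2 + c\<^sup>2 - a\<^sup>2) / (2 * c)"
  define y where "y = sqrt (b\<^sup>2 - x\<^sup>2)"
  have xc: "2 * c * x = b\<^sup>2 + c\<^sup>2 - a\<^sup>2"
    using assms by (simp add: x_def)
  have "(b - c)\<^sup>2 < a\<^sup>2"
    using assms by (intro power2_strict_mono) (auto simp: strict_triangle_def)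
  hence "2 * c * x < 2 * c * b"
    unfolding xc by (simp add: power2_eq_square algebra_simps)
  hence xb: "x < b" using assms by simp
  have "a\<^sup>2 < (b + c)\<^sup>2"
    using assms by (intro power_strict_mono) (auto simp: strict_triangle_def)
  hence "2 * c * (- b) < 2 * c * x"
    unfolding xc by (simp add: power2_eq_square algebra_simps)
  hence bx: "- b < x" using assms(3) by (simp only: mult_less_cancel_left_pos)
  have "x\<^sup>2 \<le> b\<^sup>2"
    using xb bx by (intro abs_le_square_iff[THEN iffD1]) auto
  hence y2: "y\<^sup>2 = b\<^sup>2 - x\<^sup>2" by (simp add: y_def)
  define A B C :: "real^2" where "A = 0" and "B = vector [c, 0]" and "C = vector [x, y]"
  have "(c - x)\<^sup>2 + y\<^sup>2 = a\<^sup>2"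
    using xc unfolding y2 by (simp add: power2_eq_square algebra_simps)
  hence "dist B C = a"
    using assms by (simp add: B_def C_def dist_vec_def L2_set_def sum_2 dist_real_def)
  moreover have "dist A C = b"
    using assms y2 by (simp add: A_def C_def dist_vec_def L2_set_def sum_2 dist_real_def)
  moreover have "dist A B = c"
    using assms by (simp add: A_def B_def dist_vec_def L2_set_def sum_2 dist_real_def)
  ultimately show ?thesis using that by blast
qed

lemma triangle_angle_law_of_cosines:
  assumes "0 < a" "0 < b" "0 < c" "strict_triangle a b c"
  shows "triangle_angle a b c = arccos ((b\<^sup>2 + c\<^sup>2 - a\<^sup>2) / (2 * b * c))"
proof -
  have eq: "vec_angle (B - A) (C - A) = arccos ((b\<^sup>2 + c\<^sup>2 - a\<^sup>2) / (2 * b * c))"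
    if d: "dist B C = a" "dist A C = b" "dist A B = c" for A B C :: "real^2"
  proof -
    have n: "norm (B - A) = c" "norm (C - A) = b" "norm ((B - A) - (C - A)) = a"
      using d by (simp_all add: dist_norm norm_minus_commute)
    have "a\<^sup>2 = c\<^sup>2 + b\<^sup>2 - 2 * ((B - A) \<bullet> (C - A))"
      unfolding n[symmetric] power2_norm_eq_inner
      by (simp add: inner_diff inner_commute)
    hence i: "(B - A) \<bullet> (C - A) = (b\<^sup>2 + c\<^sup>2 - a\<^sup>2) / 2" by simp
    show ?thesis unfolding vec_angle_def n i by (simp add: mult_ac)
  qed
  obtain A B C :: "real^2" where "dist B C = a" "dist A C = b" "dist A B = c"
    using triangle_exists[OF assms] .
  with eq show ?thesis
    unfolding triangle_angle_def by (intro the_equality) (metis, metis)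
qed

section \<open>Inversive distance circle packing metrics and their curvature\<close>

definition edge_length :: "('v set \<Rightarrow> real) \<Rightarrow> real^'v \<Rightarrow> 'v::finite \<Rightarrow> 'v \<Rightarrow> real" where
  "edge_length I r i j = sqrt ((r $ i)\<^sup>2 + (r $ j)\<^sup>2 + 2 * (r $ i) * (r $ j) * I {i, j})"

definition Omega :: "'v::finite set set \<Rightarrow> ('v set \<Rightarrow> real) \<Rightarrow> (real^'v) set" where
  "Omega F I =
     {r. (\<forall>i. 0 < r $ i) \<and>
         (\<forall>i j k. {i, j, k} \<in> F \<longrightarrow>
            strict_triangle (edge_length I r i j) (edge_length I r j k) (edge_length I r i k))}"

definition exp_vec :: "real^'v \<Rightarrow> real^'v::finite" where
  "exp_vec u = (\<chi> i. exp (u $ i))"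

definition ln_Omega :: "'v::finite set set \<Rightarrow> ('v set \<Rightarrow> real) \<Rightarrow> (real^'v) set" where
  "ln_Omega F I = {u. exp_vec u \<in> Omega F I}"

definition theta :: "('v set \<Rightarrow> real) \<Rightarrow> real^'v \<Rightarrow> 'v::finite \<Rightarrow> 'v \<Rightarrow> 'v \<Rightarrow> real" where
  "theta I r i j k =
     triangle_angle (edge_length I r j k) (edge_length I r i j) (edge_length I r i k)"

text \<open>If the triangle inequalities fail, exactly one of the three edge lengths is at
  least the sum of the other two; the last branch is the case where this edge ends at i.\<close>

definition gen_theta :: "('v set \<Rightarrow> real) \<Rightarrow> real^'v \<Rightarrow> 'v::finite \<Rightarrow> 'v \<Rightarrow> 'v \<Rightarrow> real" where
  "gen_theta I r i j k =
     (if strict_triangle (edge_length I r j k) (edge_length I r i j) (edge_length I r i k)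
      then theta I r i j k
      else if edge_length I r j k \<ge> edge_length I r i j + edge_length I r i k then pi
      else 0)"

text \<open>The value at vertex i of the face f of an angle function, which is symmetric in its
  last two arguments.\<close>

definition angle_in_face :: "('v \<Rightarrow> 'v \<Rightarrow> 'v \<Rightarrow> real) \<Rightarrow> 'v \<Rightarrow> 'v set \<Rightarrow> real" where
  "angle_in_face \<theta> i f = (THE \<alpha>. \<exists>j k. f = {i, j, k} \<and> \<alpha> = \<theta> i j k)"

lemma angle_in_face_eq:
  assumes "card {i, j, k} = 3" "\<theta> i j k = \<theta> i k j"
  shows "angle_in_face \<theta> i {i, j, k} = \<theta> i j k"
  unfolding angle_in_face_def
proof (rule the_equality)
  fix \<alpha> assume "\<exists>j' k'. {i, j, k} = {i, j', k'} \<and> \<alpha> = \<theta> i j' k'"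
  then obtain j' k' where jk: "{i, j, k} = {i, j', k'}" "\<alpha> = \<theta> i j' k'" by blast
  have "i \<noteq> j" "i \<noteq> k" "j \<noteq> k" using assms(1) by (auto simp: card_insert_if split: if_splits)
  moreover have "i \<noteq> j'" "i \<noteq> k'" "j' \<noteq> k'"
    using assms(1) unfolding jk(1) by (auto simp: card_insert_if split: if_splits)
  ultimately have "j = j' \<and> k = k' \<or> j = k' \<and> k = j'" using jk(1) by (auto simp: set_eq_iff)
  thus "\<alpha> = \<theta> i j k" using jk(2) assms(2) by auto
qed blast

definition curvature :: "'v::finite set set \<Rightarrow> ('v set \<Rightarrow> real) \<Rightarrow> real^'v \<Rightarrow> 'v \<Rightarrow> real" where
  "curvature F I r i = 2 * pi - (\<Sum>f | f \<in> F \<and> i \<in> f. angle_in_face (theta I r) i f)"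

definition ext_curvature :: "'v::finite set set \<Rightarrow> ('v set \<Rightarrow> real) \<Rightarrow> real^'v \<Rightarrow> 'v \<Rightarrow> real" where
  "ext_curvature F I r i = 2 * pi - (\<Sum>f | f \<in> F \<and> i \<in> f. angle_in_face (gen_theta I r) i f)"

definition K_av :: "'v::finite set set \<Rightarrow> 'v set set \<Rightarrow> real" where
  "K_av E F = 2 * pi * real_of_int (euler_char E F) / real CARD('v)"

definition constant_curvature ::
    "'v::finite set set \<Rightarrow> 'v set set \<Rightarrow> ('v set \<Rightarrow> real) \<Rightarrow> real^'v \<Rightarrow> bool" where
  "constant_curvature E F I r \<longleftrightarrow> r \<in> Omega F I \<and> (\<forall>i. curvature F I r i = K_av E F)"

section \<open>The flows\<close>

definition normalized_flow ::
    "'v::finite set set \<Rightarrow> 'v set set \<Rightarrow> ('v set \<Rightarrow> real) \<Rightarrow> real set \<Rightarrow> (real \<Rightarrow> real^'v) \<Rightarrow> bool" where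
  "normalized_flow E F I J r \<longleftrightarrow>
     (\<forall>t\<in>J. r t \<in> Omega F I \<and>
        (\<forall>i. ((\<lambda>s. r s $ i) has_real_derivative
               (K_av E F - curvature F I (r t) i) * r t $ i) (at t within J)))"

definition extended_flow ::
    "'v::finite set set \<Rightarrow> 'v set set \<Rightarrow> ('v set \<Rightarrow> real) \<Rightarrow> (real \<Rightarrow> real^'v) \<Rightarrow> bool" where
  "extended_flow E F I u \<longleftrightarrow>
     (\<forall>t\<ge>0. \<forall>i. ((\<lambda>s. u s $ i) has_real_derivative
               K_av E F - ext_curvature F I (exp_vec (u t)) i) (at t within {0..}))"

definition converges_exponentially :: "(real \<Rightarrow> real^'v::finite) \<Rightarrow> real^'v \<Rightarrow> bool" where
  "converges_exponentially u u' \<longleftrightarrow>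
     (\<exists>C>0. \<exists>c>0. \<forall>t\<ge>0. norm (u t - u') \<le> C * exp (- c * t))"

end

theory Submission
  imports Defs
begin

text \<open>In the coordinates \<open>u\<^sub>i = ln r\<^sub>i\<close> the extended flow is \<open>u' = X u\<close>, where \<open>X u\<close> has the
  components \<open>K\<^sub>a\<^sub>v - K\<^sub>i\<close>, with \<open>K\<close> the extended curvature. Everything rests on one inequality:
  \<open>X\<close> is dissipative, \<open>(X u - X v) \<bullet> (u - v) \<le> 0\<close> for all \<open>u\<close> and \<open>v\<close>, even where triangles
  degenerate (\<open>curvature_field_dissipative\<close>). The field is bounded and continuous but in
  general not Lipschitz, since an angle may have infinite slope where its triangle degenerates.
  Dissipativity makes up for this: it gives uniqueness, because two solutions never move apart,
  and it makes approximate solutions with a time delay a Cauchy sequence, which gives global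
  existence (\<open>dissipative_flow_exists\<close>).

  For convergence let \<open>p\<close> be the logarithm of a metric of constant curvature, so \<open>X p = 0\<close>.
  Angle sums make the sum of the components of \<open>X\<close> a constant, and this constant vanishes
  because it vanishes at \<open>p\<close>. Hence \<open>\<Sum>i. u\<^sub>i\<close> is conserved, and since scaling a metric changes
  no angle, \<open>p\<close> may be translated along \<open>(1,\<dots>,1)\<close> to have the same sum as the initial value. On
  the hyperplane perpendicular to \<open>(1,\<dots>,1)\<close> the derivative of \<open>X\<close> at \<open>p\<close> is negative definite.
  Dissipativity along rays from \<open>p\<close> carries the resulting local estimate to every bounded set,
  so \<open>X u \<bullet> (u - p) \<le> - c \<bar>u - p\<bar>\<^sup>2\<close> along the whole solution, which yields the exponential rate
  (\<open>dissipative_flow_converges\<close>).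

  Dissipativity is proved face by face. For a nondegenerate face with angles \<open>\<theta>\<^sub>i, \<theta>\<^sub>j, \<theta>\<^sub>k\<close> the
  form \<open>w\<^sub>i d\<theta>\<^sub>i(w) + w\<^sub>j d\<theta>\<^sub>j(w) + w\<^sub>k d\<theta>\<^sub>k(w)\<close> equals minus a weighted sum of the squares of the
  three differences of the \<open>w\<close>'s. The weights may be negative, but the discriminant of the form
  is, up to a positive constant, the squared area of the face times the ratio of the area of
  the pedal triangle of the power centre of the three vertex circles to the area of the face
  (\<open>pedal_identity\<close>). Nonnegative inversive distances put the feet of the perpendiculars from
  the power centre inside the edges, so that the discriminant is positive. To pass through
  degenerate configurations, observe that there the three angles are \<open>\<pi>, 0, 0\<close> in some order,
  so that along a segment with direction \<open>w\<close> the function \<open>\<Sum>i. w\<^sub>i \<theta>\<^sub>i\<close> has nonpositive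
  derivative except where it takes one of three values; a continuous function with this
  property is nonincreasing (\<open>nonincreasing_off_finite_values\<close>).\<close>

section \<open>Flows of dissipative vector fields\<close>

lemma has_vector_derivative_norm_sq:
  fixes y :: "real \<Rightarrow> 'a::real_inner"
  assumes "(y has_vector_derivative y') (at t within S)"
  shows "((\<lambda>t. (norm (y t))\<^sup>2) has_real_derivative 2 * (y' \<bullet> y t)) (at t within S)"
proof -
  have "((\<lambda>t. y t \<bullet> y t) has_derivative (\<lambda>h. y t \<bullet> (h *\<^sub>R y') + (h *\<^sub>R y') \<bullet> y t)) (at t within S)"
    using has_derivative_inner assms unfolding has_vector_derivative_def by blast
  thus ?thesis
    unfolding has_field_derivative_def power2_norm_eq_inner
    by (rule has_derivative_eq_rhs) (auto simp: inner_commute)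
qed

lemma real_derivative_bound_imp_growth_bound:
  fixes f :: "real \<Rightarrow> real"
  assumes "a \<le> b"
    and f: "\<And>t. t \<in> {a..b} \<Longrightarrow> (f has_real_derivative f' t) (at t within {a..b})"
    and le: "\<And>t. t \<in> {a..b} \<Longrightarrow> f' t \<le> c"
  shows "f b \<le> f a + c * (b - a)"
proof -
  have "\<exists>t\<in>{a..b}. f b - f a = f' t * (b - a)"
    by (rule mvt_very_simple[OF assms(1)]) (use f in \<open>auto simp: has_field_derivative_def\<close>)
  then obtain t where "t \<in> {a..b}" "f b - f a = f' t * (b - a)" by blast
  moreover from this have "f' t * (b - a) \<le> c * (b - a)"
    using le assms(1) by (intro mult_right_mono) auto
  ultimately show ?thesis by linarith
qed

lemma vector_derivative_bound_imp_lipschitz: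
  fixes y :: "real \<Rightarrow> 'a::real_normed_vector"
  assumes y: "\<And>t. t \<in> {0..T} \<Longrightarrow> (y has_vector_derivative y' t) (at t within {0..T})"
    and C: "\<And>t. t \<in> {0..T} \<Longrightarrow> norm (y' t) \<le> C"
    and "s \<in> {0..T}" "t \<in> {0..T}"
  shows "norm (y s - y t) \<le> C * \<bar>s - t\<bar>"
proof -
  have "norm (y s - y t) \<le> C * norm (s - t)"
  proof (rule differentiable_bound[OF _ _ _ assms(3,4)])
    show "(y has_derivative (\<lambda>h. h *\<^sub>R y' x)) (at x within {0..T})" if "x \<in> {0..T}" for x
      using y[OF that] by (simp add: has_vector_derivative_def)
    show "onorm (\<lambda>h. h *\<^sub>R y' x) \<le> C" if "x \<in> {0..T}" for x
      using C[OF that] onorm_scaleR_left[OF bounded_linear_ident, of "y' x"] by (simp add: onorm_id)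
  qed auto
  thus ?thesis by simp
qed

text \<open>Dissipativity takes the place of a Lipschitz condition: the squared distance of two
  solutions has nonpositive derivative.\<close>

lemma dissipative_flow_unique:
  fixes X :: "'a::real_inner \<Rightarrow> 'a"
  assumes diss: "\<And>u v. (X u - X v) \<bullet> (u - v) \<le> 0"
    and "0 \<le> T"
    and y: "\<And>t. t \<in> {0..T} \<Longrightarrow> (y has_vector_derivative X (y t)) (at t within {0..T})"
    and z: "\<And>t. t \<in> {0..T} \<Longrightarrow> (z has_vector_derivative X (z t)) (at t within {0..T})"
    and "y 0 = z 0"
  shows "y T = z T"
proof -
  have "(norm (y T - z T))\<^sup>2 \<le> (norm (y 0 - z 0))\<^sup>2 + 0 * (T - 0)"
  proof (rule real_derivative_bound_imp_growth_bound[OF assms(2)])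
    fix t assume t: "t \<in> {0..T}"
    show "((\<lambda>t. (norm (y t - z t))\<^sup>2) has_real_derivative
        2 * ((X (y t) - X (z t)) \<bullet> (y t - z t))) (at t within {0..T})"
      using has_vector_derivative_norm_sq[OF has_vector_derivative_diff[OF y[OF t] z[OF t]]] .
    show "2 * ((X (y t) - X (z t)) \<bullet> (y t - z t)) \<le> 0" using diss[of "y t" "z t"] by simp
  qed
  thus ?thesis using assms(5) by simp
qed

text \<open>Tonelli's approximation. On \<open>[n h, (n + 1) h]\<close> the delayed right-hand side involves the
  solution only up to time \<open>n h\<close>, so iterating the integral operator from a constant function
  gives, after \<open>n\<close> steps, a function that is final on \<open>[0, n h]\<close>. The maximum with 0 prolongs
  the solution by its initial value to negative times.\<close>

lemma delayed_flow_exists: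
  fixes X :: "'a::euclidean_space \<Rightarrow> 'a"
  assumes cont: "continuous_on UNIV X" and "0 < h"
  shows "\<exists>y. y 0 = u0 \<and>
    (\<forall>t\<in>{0..T}. (y has_vector_derivative X (y (max 0 (t - h)))) (at t within {0..T}))"
proof -
  define G where "G = (\<lambda>v t. u0 + integral {0..t} (\<lambda>s. X (v (max 0 (s - h)))))"
  define v where "v = (\<lambda>n. (G ^^ n) (\<lambda>_. u0))"
  have v_Suc: "v (Suc n) = G (v n)" for n by (simp add: v_def)
  have G_deriv: "(G w has_vector_derivative X (w (max 0 (t - h)))) (at t within {0..T})"
    if "continuous_on {0..} w" "t \<in> {0..T}" for w t T
  proof -
    have "continuous_on {0..T} (\<lambda>s. X (w (max 0 (s - h))))"
      by (rule continuous_on_compose2[OF cont continuous_on_compose2[OF that(1)]])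
        (auto intro!: continuous_intros)
    hence "((\<lambda>t. integral {0..t} (\<lambda>s. X (w (max 0 (s - h))))) has_vector_derivative
        X (w (max 0 (t - h)))) (at t within {0..T})"
      using that(2) by (rule integral_has_vector_derivative)
    from has_vector_derivative_add[OF has_vector_derivative_const this]
    show ?thesis by (simp add: G_def)
  qed
  have v_cont: "continuous_on {0..} (v n)" for n
  proof (induction n)
    case (Suc n)
    have "continuous (at t within {0..}) (v (Suc n))" if "t \<in> {0..}" for t
    proof -
      have "continuous (at t within {0..t + 1}) (v (Suc n))"
        unfolding v_Suc by (rule has_vector_derivative_continuous[OF G_deriv[OF Suc]]) (use that in auto)
      moreover have "at t within {0..t + 1} = at t within {0..}"
        by (rule at_within_nhd[of t "{..<t + 1}"]) auto
      ultimately show ?thesis by (simp add: continuous_within)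
    qed
    thus ?case by (simp add: continuous_on_eq_continuous_within)
  qed (simp add: v_def)
  have agree: "v n t = v (Suc n) t" if "0 \<le> t" "t \<le> real n * h" for n t
    using that
  proof (induction n arbitrary: t)
    case 0
    hence "t = 0" by simp
    thus ?case by (simp add: v_Suc G_def) (simp add: v_def)
  next
    case (Suc n)
    have "G (v n) t = G (v (Suc n)) t"
      unfolding G_def
    proof (intro arg_cong2[where f = "(+)"] refl integral_cong arg_cong[where f = X] Suc.IH)
      fix s assume "s \<in> {0..t}"
      thus "max 0 (s - h) \<le> real n * h" using Suc.prems assms(2) by (auto simp: algebra_simps)
    qed simp
    thus ?case by (simp only: v_Suc)
  qed
  obtain N :: nat where N: "T / h \<le> real N" using real_arch_simple by blast
  hence N: "T \<le> real N * h" using assms(2) by (simp add: field_simps)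
  let ?y = "v (Suc N)"
  have "?y 0 = u0" by (simp add: v_Suc G_def)
  moreover have "(?y has_vector_derivative X (?y (max 0 (t - h)))) (at t within {0..T})"
    if t: "t \<in> {0..T}" for t
  proof -
    have "v N (max 0 (t - h)) = ?y (max 0 (t - h))"
      by (rule agree) (use t N assms(2) in auto)
    thus ?thesis using G_deriv[OF v_cont t, of N] by (simp add: v_Suc)
  qed
  ultimately show ?thesis by blast
qed

text \<open>Dissipativity controls \<open>(X a - X b) \<bullet> (a - b)\<close> for the delayed positions \<open>a\<close> and \<open>b\<close>. The
  speed bound \<open>C\<close> keeps these within \<open>C h\<close> and \<open>C k\<close> of the current positions, so the squared
  distance grows at most at the rate \<open>4 C\<^sup>2 (h + k)\<close>.\<close>

lemma delayed_flows_close: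
  fixes X :: "'a::euclidean_space \<Rightarrow> 'a"
  assumes diss: "\<And>u v. (X u - X v) \<bullet> (u - v) \<le> 0"
    and bdd: "\<And>u. norm (X u) \<le> C"
    and hk: "0 < h" "0 < k" and T: "0 \<le> T"
    and y: "\<And>t. t \<in> {0..T} \<Longrightarrow> (y has_vector_derivative X (y (max 0 (t - h)))) (at t within {0..T})"
    and z: "\<And>t. t \<in> {0..T} \<Longrightarrow> (z has_vector_derivative X (z (max 0 (t - k)))) (at t within {0..T})"
    and "y 0 = z 0"
  shows "(norm (y T - z T))\<^sup>2 \<le> 4 * C\<^sup>2 * (h + k) * T"
proof -
  have C: "0 \<le> C" using bdd[of 0] norm_ge_zero order_trans by blast
  have "(norm (y T - z T))\<^sup>2 \<le> (norm (y 0 - z 0))\<^sup>2 + 4 * C\<^sup>2 * (h + k) * (T - 0)"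
  proof (rule real_derivative_bound_imp_growth_bound[OF T])
    fix t assume t: "t \<in> {0..T}"
    define a b where "a = y (max 0 (t - h))" and "b = z (max 0 (t - k))"
    show "((\<lambda>t. (norm (y t - z t))\<^sup>2) has_real_derivative
        2 * ((X a - X b) \<bullet> (y t - z t))) (at t within {0..T})"
      using has_vector_derivative_norm_sq[OF has_vector_derivative_diff[OF y[OF t] z[OF t]]]
      unfolding a_def b_def .
    have "norm (y t - a) \<le> C * \<bar>t - max 0 (t - h)\<bar>" unfolding a_def
      by (rule vector_derivative_bound_imp_lipschitz[OF y]) (use bdd t hk in auto)
    also have "\<dots> \<le> C * h" using C t hk by (intro mult_left_mono) auto
    finally have ya: "norm (y t - a) \<le> C * h" .
    have "norm (z t - b) \<le> C * \<bar>t - max 0 (t - k)\<bar>" unfolding b_def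
      by (rule vector_derivative_bound_imp_lipschitz[OF z]) (use bdd t hk in auto)
    also have "\<dots> \<le> C * k" using C t hk by (intro mult_left_mono) auto
    finally have zb: "norm (z t - b) \<le> C * k" .
    have "norm ((y t - a) - (z t - b)) \<le> C * h + C * k"
      using norm_triangle_ineq4[of "y t - a" "z t - b"] ya zb by linarith
    moreover have "norm (X a - X b) \<le> 2 * C"
      using norm_triangle_ineq4[of "X a" "X b"] bdd[of a] bdd[of b] by linarith
    ultimately have "norm (X a - X b) * norm ((y t - a) - (z t - b)) \<le> (2 * C) * (C * h + C * k)"
      using C by (intro mult_mono) auto
    hence "(X a - X b) \<bullet> ((y t - a) - (z t - b)) \<le> (2 * C) * (C * h + C * k)"
      using norm_cauchy_schwarz order_trans by blast
    moreover have "(X a - X b) \<bullet> (y t - z t)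
        = (X a - X b) \<bullet> (a - b) + (X a - X b) \<bullet> ((y t - a) - (z t - b))"
      by (simp add: inner_diff algebra_simps)
    ultimately show "2 * ((X a - X b) \<bullet> (y t - z t)) \<le> 4 * C\<^sup>2 * (h + k)"
      using diss[of a b] by (simp add: power2_eq_square algebra_simps)
  qed
  thus ?thesis using assms(8) by simp
qed

text \<open>Delayed solutions with delays tending to 0 form a Cauchy sequence at each time. Their
  limit inherits the Lipschitz constant \<open>C\<close>, and dominated convergence turns the delayed
  integral equations into the integral equation of the flow.\<close>

theorem dissipative_flow_exists:
  fixes X :: "'a::euclidean_space \<Rightarrow> 'a"
  assumes cont: "continuous_on UNIV X"
    and diss: "\<And>u v. (X u - X v) \<bullet> (u - v) \<le> 0"
    and bdd: "\<And>u. norm (X u) \<le> C"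
  shows "\<exists>u. u 0 = u0 \<and> (\<forall>t\<ge>0. (u has_vector_derivative X (u t)) (at t within {0..}))"
proof -
  define h where "h n = inverse (real (Suc n))" for n
  have h: "0 < h n" for n by (simp add: h_def)
  have h_lim: "h \<longlonglongrightarrow> 0" unfolding h_def by (rule LIMSEQ_inverse_real_of_nat)
  have C: "0 \<le> C" using bdd[of 0] norm_ge_zero order_trans by blast
  have "\<forall>n. \<exists>y. y 0 = u0 \<and> (\<forall>t\<in>{0..real n}.
      (y has_vector_derivative X (y (max 0 (t - h n)))) (at t within {0..real n}))"
    using delayed_flow_exists[OF cont h] by blast
  then obtain y where y0: "\<And>n. y n 0 = u0"
    and y: "\<And>n t. t \<in> {0..real n} \<Longrightarrow>
      (y n has_vector_derivative X (y n (max 0 (t - h n)))) (at t within {0..real n})"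
    by metis
  have y_sub: "(y n has_vector_derivative X (y n (max 0 (t - h n)))) (at t within {0..T})"
    if "T \<le> real n" "t \<in> {0..T}" for n t T
    by (rule has_vector_derivative_within_subset[OF y]) (use that in auto)
  have lip: "norm (y n s - y n t) \<le> C * \<bar>s - t\<bar>"
    if "s \<in> {0..real n}" "t \<in> {0..real n}" for n s t
    by (rule vector_derivative_bound_imp_lipschitz[OF y]) (use that bdd in auto)
  have "Cauchy (\<lambda>n. y n t)" if t: "0 \<le> t" for t
  proof (rule metric_CauchyI)
    fix e :: real assume e: "0 < e"
    have "(\<lambda>n. 4 * C\<^sup>2 * (h n + h n) * t) \<longlonglongrightarrow> 4 * C\<^sup>2 * (0 + 0) * t"
      by (intro tendsto_intros h_lim)
    hence "\<forall>\<^sub>F n in sequentially. 4 * C\<^sup>2 * (h n + h n) * t < e\<^sup>2"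
      by (rule order_tendstoD) (use e in simp)
    then obtain N where N: "4 * C\<^sup>2 * (h N + h N) * t < e\<^sup>2" "t \<le> real N"
      using eventually_conj[OF _ eventually_ge_at_top[of "nat \<lceil>t\<rceil>"]] 
        eventually_happens'[OF sequentially_bot] by (metis (no_types, lifting) nat_ceiling_le_eq)
    have "dist (y m t) (y n t) < e" if mn: "N \<le> m" "N \<le> n" for m n
    proof -
      have hm: "h m \<le> h N" "h n \<le> h N" using mn by (auto simp: h_def field_simps)
      have "(norm (y m t - y n t))\<^sup>2 \<le> 4 * C\<^sup>2 * (h m + h n) * t"
        by (rule delayed_flows_close[OF diss bdd h h t])
          (use mn N(2) y0 in \<open>auto intro!: y_sub\<close>)
      also have "\<dots> \<le> 4 * C\<^sup>2 * (h N + h N) * t"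
        using hm t by (intro mult_right_mono mult_left_mono add_mono) auto
      also have "\<dots> < e\<^sup>2" by (rule N)
      finally have "norm (y m t - y n t) < e" using e by (simp add: power2_less_imp_less)
      thus ?thesis by (simp add: dist_norm)
    qed
    thus "\<exists>M. \<forall>m\<ge>M. \<forall>n\<ge>M. dist (y m t) (y n t) < e" by blast
  qed
  hence "\<forall>t. \<exists>l. 0 \<le> t \<longrightarrow> (\<lambda>n. y n t) \<longlonglongrightarrow> l"
    by (meson Cauchy_convergent_iff convergent_def)
  then obtain u where u: "\<And>t. 0 \<le> t \<Longrightarrow> (\<lambda>n. y n t) \<longlonglongrightarrow> u t" by metis
  have large: "\<forall>\<^sub>F n in sequentially. t \<le> real n" for t
    using eventually_ge_at_top[of "nat \<lceil>t\<rceil>"] by eventually_elim linarith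
  have u_lip: "norm (u s - u t) \<le> C * \<bar>s - t\<bar>" if "0 \<le> s" "0 \<le> t" for s t
  proof (rule tendsto_upperbound[OF tendsto_norm[OF tendsto_diff[OF u[OF that(1)] u[OF that(2)]]]])
    show "\<forall>\<^sub>F n in sequentially. norm (y n s - y n t) \<le> C * \<bar>s - t\<bar>"
      using large[of s] large[of t] by eventually_elim (use lip that in auto)
  qed simp
  have u_cont: "continuous_on {0..} u"
    by (rule lipschitz_on_continuous_on[of C], rule lipschitz_onI)
      (use u_lip C in \<open>auto simp: dist_norm\<close>)
  have delayed_lim: "(\<lambda>n. y n (max 0 (t - h n))) \<longlonglongrightarrow> u t" if t: "0 \<le> t" for t
  proof -
    have "(\<lambda>n. y n (max 0 (t - h n)) - y n t) \<longlonglongrightarrow> 0"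
    proof (rule tendsto_norm_zero_cancel, rule tendsto_sandwich[of "\<lambda>_. 0"])
      show "\<forall>\<^sub>F n in sequentially. norm (y n (max 0 (t - h n)) - y n t) \<le> C * h n"
        using large[of t]
      proof eventually_elim
        case (elim n)
        have "norm (y n (max 0 (t - h n)) - y n t) \<le> C * \<bar>max 0 (t - h n) - t\<bar>"
          by (rule lip) (use elim t h[of n] in auto)
        also have "\<dots> \<le> C * h n" using C t h[of n] by (intro mult_left_mono) auto
        finally show ?case .
      qed
      show "(\<lambda>n. C * h n) \<longlonglongrightarrow> 0" using tendsto_mult_right_zero[OF h_lim] .
    qed auto
    from tendsto_add[OF this u[OF t]] show ?thesis by simp
  qed
  have u_int: "u t = u0 + integral {0..t} (\<lambda>s. X (u s))" if t: "0 \<le> t" for t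
  proof -
    obtain N :: nat where N: "t \<le> real N" using real_arch_simple by blast
    define f where "f = (\<lambda>n s. X (y (n + N) (max 0 (s - h (n + N)))))"
    have ftc: "(f n has_integral y (n + N) t - u0) {0..t}" for n
      using fundamental_theorem_of_calculus[OF t y_sub[of t "n + N"]] N y0
      unfolding f_def by simp
    have "(\<lambda>n. integral {0..t} (f n)) \<longlonglongrightarrow> integral {0..t} (\<lambda>s. X (u s))"
    proof (rule dominated_convergence(2))
      show "f n integrable_on {0..t}" for n using ftc by blast
      show "(\<lambda>_. C) integrable_on {0..t}" by (rule integrable_const_ivl)
      show "norm (f n s) \<le> C" for n s using bdd by (simp add: f_def)
      show "(\<lambda>n. f n s) \<longlonglongrightarrow> X (u s)" if "s \<in> {0..t}" for s
        unfolding f_def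
        by (rule isCont_tendsto_compose[of _ X], use cont in \<open>simp add: continuous_on_eq_continuous_at\<close>)
          (use LIMSEQ_ignore_initial_segment[OF delayed_lim] that in simp)
    qed
    moreover have "(\<lambda>n. integral {0..t} (f n)) \<longlonglongrightarrow> u t - u0"
      unfolding integral_unique[OF ftc]
      by (intro tendsto_intros LIMSEQ_ignore_initial_segment u t)
    ultimately show ?thesis using LIMSEQ_unique by (metis add.commute diff_add_cancel)
  qed
  have "(u has_vector_derivative X (u t)) (at t within {0..})" if t: "0 \<le> t" for t
  proof -
    have "continuous_on {0..t + 1} (\<lambda>s. X (u s))"
      by (rule continuous_on_compose2[OF cont continuous_on_subset[OF u_cont]]) auto
    from integral_has_vector_derivative[OF this, of t]
    have "((\<lambda>t. u0 + integral {0..t} (\<lambda>s. X (u s))) has_vector_derivative X (u t)) (at t within {0..t + 1})"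
      using t by (auto intro!: derivative_eq_intros)
    hence "(u has_vector_derivative X (u t)) (at t within {0..t + 1})"
      by (rule has_vector_derivative_transform[rotated 2]) (use t u_int in auto)
    moreover have "at t within {0..t + 1} = at t within {0..}"
      by (rule at_within_nhd[of t "{..<t + 1}"]) auto
    ultimately show ?thesis by (simp add: has_vector_derivative_def has_derivative_within)
  qed
  moreover have "u 0 = u0" using u_int[of 0] by simp
  ultimately show ?thesis by blast
qed

text \<open>For short \<open>v\<close> the estimate comes from the derivative at \<open>p\<close>, whose quadratic form is
  bounded away from 0 on the compact unit sphere of the hyperplane. For longer \<open>v\<close>,
  dissipativity says that \<open>X (p + s v) \<bullet> v\<close> is nonincreasing in \<open>s\<close>, so its value at distance
  \<open>\<delta>\<close> from \<open>p\<close> is still a bound; up to the distance \<open>R\<close> this costs only the factor \<open>\<delta> / R\<close>.\<close>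

lemma dissipative_flow_coercive:
  fixes X :: "'a::euclidean_space \<Rightarrow> 'a"
  assumes diss: "\<And>u v. (X u - X v) \<bullet> (u - v) \<le> 0"
    and zero: "X p = 0"
    and D: "(X has_derivative D) (at p)"
    and neg: "\<And>w. w \<bullet> e = 0 \<Longrightarrow> w \<noteq> 0 \<Longrightarrow> D w \<bullet> w < 0"
    and R: "0 < R"
  shows "\<exists>c>0. \<forall>v. v \<bullet> e = 0 \<longrightarrow> norm v \<le> R \<longrightarrow> X (p + v) \<bullet> v \<le> - c * (norm v)\<^sup>2"
proof -
  interpret D: bounded_linear D using D by (rule has_derivative_bounded_linear)
  define K where "K = sphere 0 1 \<inter> {w::'a. w \<bullet> e = 0}"
  have K: "compact K" unfolding K_def
    by (intro compact_Int_closed compact_sphere closed_Collect_eq continuous_intros)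
  have "\<exists>m>0. \<forall>w\<in>K. D w \<bullet> w \<le> - m"
  proof (cases "K = {}")
    case True
    thus ?thesis by (intro exI[of _ 1]) auto
  next
    case False
    have "continuous_on K (\<lambda>w. D w \<bullet> w)"
      by (intro continuous_intros linear_continuous_on D.bounded_linear_axioms)
    then obtain w where w: "w \<in> K" "\<forall>w'\<in>K. D w' \<bullet> w' \<le> D w \<bullet> w"
      using continuous_attains_sup[OF K False] by blast
    moreover have "D w \<bullet> w < 0" using w(1) by (intro neg) (auto simp: K_def)
    ultimately show ?thesis by (intro exI[of _ "- (D w \<bullet> w)"]) auto
  qed
  then obtain m where m: "0 < m" "\<And>w. w \<in> K \<Longrightarrow> D w \<bullet> w \<le> - m" by blast
  have Dm: "D w \<bullet> w \<le> - m * (norm w)\<^sup>2" if "w \<bullet> e = 0" for w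
  proof (cases "w = 0")
    case False
    have "w /\<^sub>R norm w \<in> K" using False that by (simp add: K_def)
    have eq: "D (w /\<^sub>R norm w) \<bullet> (w /\<^sub>R norm w) = D w \<bullet> w / (norm w)\<^sup>2"
      by (simp add: D.scaleR power2_eq_square divide_inverse)
    from m(2)[OF \<open>w /\<^sub>R norm w \<in> K\<close>] have "D w \<bullet> w / (norm w)\<^sup>2 \<le> - m"
      unfolding eq .
    hence "D w \<bullet> w \<le> - m * (norm w)\<^sup>2" using False by (subst (asm) pos_divide_le_eq) auto
    thus ?thesis .
  qed (simp add: D.zero)
  obtain d where d: "0 < d"
    "\<And>y. norm (y - p) < d \<Longrightarrow> norm (X y - X p - D (y - p)) \<le> m / 2 * norm (y - p)"
    using D m(1) unfolding has_derivative_at_alt by (metis half_gt_zero)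
  define \<delta> where "\<delta> = d / 2"
  have \<delta>: "0 < \<delta>" "\<delta> < d" using d by (simp_all add: \<delta>_def)
  have near: "X (p + v) \<bullet> v \<le> - (m / 2) * (norm v)\<^sup>2" if "v \<bullet> e = 0" "norm v \<le> \<delta>" for v
  proof -
    have "(X (p + v) - D v) \<bullet> v \<le> norm (X (p + v) - D v) * norm v" by (rule norm_cauchy_schwarz)
    also have "\<dots> \<le> (m / 2 * norm v) * norm v"
      using d(2)[of "p + v"] that \<delta> zero by (intro mult_right_mono) auto
    finally show ?thesis using Dm[OF that(1)] by (simp add: inner_diff power2_eq_square)
  qed
  \<comment> \<open>The two factors serve the vectors of length at most \<open>\<delta>\<close> and those beyond.\<close>
  define c where "c = m / 2 * min 1 (\<delta> / R)"
  have "0 < c" using m \<delta> R by (simp add: c_def)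
  moreover have "X (p + v) \<bullet> v \<le> - c * (norm v)\<^sup>2" if v: "v \<bullet> e = 0" "norm v \<le> R" for v
  proof (cases "norm v \<le> \<delta>")
    case True
    have "c \<le> m / 2 * 1" unfolding c_def using m by (intro mult_left_mono) auto
    hence "c * (norm v)\<^sup>2 \<le> m / 2 * (norm v)\<^sup>2" by (intro mult_right_mono) auto
    with near[OF v(1) True] show ?thesis by simp
  next
    case False
    define s where "s = \<delta> / norm v"
    have nv: "0 < norm v" using False \<delta> by linarith
    have s: "0 < s" "s < 1" unfolding s_def
      using divide_pos_pos[OF \<delta>(1) nv] False nv by (simp_all only: divide_less_eq_1_pos not_le)
    have sR: "\<delta> / R \<le> s" unfolding s_def using v \<delta> nv R by (intro divide_left_mono) auto
    have "(X (p + v) - X (p + s *\<^sub>R v)) \<bullet> ((1 - s) *\<^sub>R v) \<le> 0"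
      using diss[of "p + v" "p + s *\<^sub>R v"] by (simp add: scaleR_diff_left)
    hence 1: "X (p + v) \<bullet> v \<le> X (p + s *\<^sub>R v) \<bullet> v"
      using s by (simp add: mult_le_0_iff inner_diff)
    have ray: "X (p + s *\<^sub>R v) \<bullet> (s *\<^sub>R v) \<le> - (m / 2) * (norm (s *\<^sub>R v))\<^sup>2"
    proof (rule near)
      have "s * norm v = \<delta>" using nv by (simp add: s_def)
      thus "norm (s *\<^sub>R v) \<le> \<delta>" by (simp only: norm_scaleR abs_of_pos[OF s(1)])
    qed (simp add: v)
    have sq: "(norm (s *\<^sub>R v))\<^sup>2 = s * (s * (norm v)\<^sup>2)"
      by (simp add: power_mult_distrib power2_eq_square)
    have "s * (X (p + s *\<^sub>R v) \<bullet> v) \<le> s * (- (m / 2 * s * (norm v)\<^sup>2))"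
      using ray unfolding sq inner_scaleR_right by (simp add: mult_ac)
    hence 2: "X (p + s *\<^sub>R v) \<bullet> v \<le> - (m / 2 * s * (norm v)\<^sup>2)"
      using s(1) by (simp only: mult_le_cancel_left_pos)
    have "c \<le> m / 2 * s" unfolding c_def using m sR by (intro mult_left_mono) auto
    hence "c * (norm v)\<^sup>2 \<le> m / 2 * s * (norm v)\<^sup>2" by (intro mult_right_mono) auto
    with 1 2 show ?thesis by simp
  qed
  ultimately show ?thesis by blast
qed

text \<open>The solution stays on the hyperplane through \<open>p\<close> perpendicular to \<open>e\<close>, and by
  dissipativity in a ball around \<open>p\<close>. Coercivity on this ball makes \<open>\<bar>u - p\<bar>\<^sup>2 exp (2 c t)\<close>
  nonincreasing.\<close>

theorem dissipative_flow_converges: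
  fixes X :: "'a::euclidean_space \<Rightarrow> 'a"
  assumes diss: "\<And>u v. (X u - X v) \<bullet> (u - v) \<le> 0"
    and zero: "X p = 0"
    and D: "(X has_derivative D) (at p)"
    and neg: "\<And>w. w \<bullet> e = 0 \<Longrightarrow> w \<noteq> 0 \<Longrightarrow> D w \<bullet> w < 0"
    and conserved: "\<And>v. X v \<bullet> e = 0"
    and start: "(u 0 - p) \<bullet> e = 0"
    and u: "\<And>t. 0 \<le> t \<Longrightarrow> (u has_vector_derivative X (u t)) (at t within {0..})"
  shows "\<exists>C>0. \<exists>c>0. \<forall>t\<ge>0. norm (u t - p) \<le> C * exp (- c * t)"
proof -
  \<comment> \<open>The summand 1 keeps the radius positive when the solution starts at the equilibrium.\<close>
  define R where "R = norm (u 0 - p) + 1"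
  have R: "0 < R" by (simp add: R_def add_nonneg_pos)
  from dissipative_flow_coercive[OF diss zero D neg R]
  obtain c where c: "0 < c" "\<And>v. v \<bullet> e = 0 \<Longrightarrow> norm v \<le> R \<Longrightarrow> X (p + v) \<bullet> v \<le> - c * (norm v)\<^sup>2"
    by blast
  have u_sub: "((\<lambda>t. u t - p) has_vector_derivative X (u t)) (at t within {0..T})" if "t \<in> {0..T}" for t T
  proof -
    have "(u has_vector_derivative X (u t)) (at t within {0..T})"
      by (rule has_vector_derivative_within_subset[OF u]) (use that in auto)
    from has_vector_derivative_diff[OF this has_vector_derivative_const] show ?thesis by simp
  qed
  note sq = has_vector_derivative_norm_sq[OF u_sub]
  have perp: "(u T - p) \<bullet> e = 0" if T: "0 \<le> T" for T
  proof -
    have d: "((\<lambda>t. (u t - p) \<bullet> e) has_real_derivative 0) (at t within {0..T})" if "t \<in> {0..T}" for t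
      unfolding has_field_derivative_def
      by (rule has_derivative_eq_rhs[OF has_derivative_inner_left[OF
            u_sub[OF that, unfolded has_vector_derivative_def]]])
        (simp add: fun_eq_iff conserved)
    have "(u T - p) \<bullet> e \<le> (u 0 - p) \<bullet> e + 0 * (T - 0)"
      by (rule real_derivative_bound_imp_growth_bound[OF T d]) auto
    moreover have "- ((u T - p) \<bullet> e) \<le> - ((u 0 - p) \<bullet> e) + 0 * (T - 0)"
      by (rule real_derivative_bound_imp_growth_bound[OF T DERIV_minus[OF d]]) auto
    ultimately show ?thesis using start by linarith
  qed
  have bounded: "norm (u T - p) \<le> R" if T: "0 \<le> T" for T
  proof -
    have "(norm (u T - p))\<^sup>2 \<le> (norm (u 0 - p))\<^sup>2 + 0 * (T - 0)"
      by (rule real_derivative_bound_imp_growth_bound[OF T sq])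
        (use diss[of _ p] zero in auto)
    hence "(norm (u T - p))\<^sup>2 \<le> (norm (u 0 - p))\<^sup>2" by simp
    hence "norm (u T - p) \<le> norm (u 0 - p)" by (rule power2_le_imp_le) simp
    thus ?thesis by (simp add: R_def)
  qed
  have "norm (u T - p) \<le> R * exp (- c * T)" if T: "0 \<le> T" for T
  proof -
    have "(norm (u T - p))\<^sup>2 * (exp (c * T))\<^sup>2 \<le> (norm (u 0 - p))\<^sup>2 * (exp (c * 0))\<^sup>2 + 0 * (T - 0)"
    proof (rule real_derivative_bound_imp_growth_bound[OF T])
      fix t assume t: "t \<in> {0..T}"
      have "((\<lambda>t. (exp (c * t))\<^sup>2) has_real_derivative 2 * c * (exp (c * t))\<^sup>2) (at t within {0..T})"
        by (auto intro!: derivative_eq_intros simp: power2_eq_square)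
      from DERIV_mult[OF sq[OF t] this]
      show "((\<lambda>t. (norm (u t - p))\<^sup>2 * (exp (c * t))\<^sup>2) has_real_derivative
          2 * (X (u t) \<bullet> (u t - p) + c * (norm (u t - p))\<^sup>2) * (exp (c * t))\<^sup>2) (at t within {0..T})"
        by (rule DERIV_cong) (simp add: algebra_simps)
      have "X (u t) \<bullet> (u t - p) \<le> - c * (norm (u t - p))\<^sup>2"
        using c(2)[of "u t - p"] perp bounded t by simp
      thus "2 * (X (u t) \<bullet> (u t - p) + c * (norm (u t - p))\<^sup>2) * (exp (c * t))\<^sup>2 \<le> 0"
        by (intro mult_nonpos_nonneg[OF _ zero_le_power2]) simp
    qed
    hence "(norm (u T - p) * exp (c * T))\<^sup>2 \<le> (norm (u 0 - p))\<^sup>2"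
      by (simp add: power_mult_distrib)
    hence "norm (u T - p) * exp (c * T) \<le> norm (u 0 - p)" by (rule power2_le_imp_le) simp
    also have "\<dots> \<le> R" by (simp add: R_def)
    finally show ?thesis by (simp add: exp_minus field_simps)
  qed
  thus ?thesis using R c(1) by blast
qed


section \<open>Generalized angles in terms of squared edge lengths\<close>

text \<open>Sixteen times the squared area of the triangle with squared side lengths \<open>A\<close>, \<open>B\<close>, \<open>C\<close>.\<close>

definition heron :: "real \<Rightarrow> real \<Rightarrow> real \<Rightarrow> real" where
  "heron A B C = 2*A*B + 2*B*C + 2*C*A - A\<^sup>2 - B\<^sup>2 - C\<^sup>2"

text \<open>The law of cosines for the angle opposite to the side of squared length \<open>A\<close>. Clamping the
  cosine to \<open>[-1, 1]\<close> produces exactly the values \<open>\<pi>\<close> and 0 that the generalized angles have on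
  degenerate triangles, so that one continuous formula covers all cases.\<close>

definition clamped_angle :: "real \<Rightarrow> real \<Rightarrow> real \<Rightarrow> real" where
  "clamped_angle A B C = arccos (max (-1) (min 1 ((B + C - A) / (2 * sqrt (B * C)))))"

lemma clamped_angle_commute: "clamped_angle A B C = clamped_angle A C B"
  by (simp add: clamped_angle_def add.commute mult.commute)

lemma heron_commute: "heron B A C = heron A B C" "heron C A B = heron A B C"
    "heron B C A = heron A B C" "heron A C B = heron A B C" "heron C B A = heron A B C"
  by (simp_all add: heron_def)

lemma heron_eq: "heron A B C = 4 * B * C - (B + C - A)\<^sup>2"
  by (simp add: heron_def power2_eq_square algebra_simps)

lemma heron_pos_iff_strict_triangle:
  assumes "0 < a" "0 < b" "0 < c"
  shows "0 < heron (a\<^sup>2) (b\<^sup>2) (c\<^sup>2) \<longleftrightarrow> strict_triangle a b c"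
proof -
  have eq: "heron (a\<^sup>2) (b\<^sup>2) (c\<^sup>2) = (a + b + c) * ((b + c - a) * ((a + c - b) * (a + b - c)))"
    unfolding heron_def by algebra
  have iff: "0 < heron (a\<^sup>2) (b\<^sup>2) (c\<^sup>2) \<longleftrightarrow> 0 < (b + c - a) * ((a + c - b) * (a + b - c))"
    unfolding eq using assms by (simp add: zero_less_mult_iff)
  have "(b + c - a) * ((a + c - b) * (a + b - c)) \<le> 0" if ns: "\<not> strict_triangle a b c"
  proof -
    consider "b + c \<le> a" | "a + c \<le> b" | "a + b \<le> c"
      using ns by (force simp: strict_triangle_def)
    thus ?thesis
    proof cases
      case 1
      thus ?thesis using assms by (intro mult_nonpos_nonneg mult_nonneg_nonneg) auto
    next
      case 2
      thus ?thesis using assms by (intro mult_nonneg_nonpos mult_nonpos_nonneg) auto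
    next
      case 3
      thus ?thesis using assms by (intro mult_nonneg_nonpos) auto
    qed
  qed
  thus ?thesis unfolding iff by (fastforce simp: strict_triangle_def)
qed

lemma degenerate_clamped_angles:
  assumes "0 < a" "0 < b" "0 < c" "b + c \<le> a"
  shows "clamped_angle (a\<^sup>2) (b\<^sup>2) (c\<^sup>2) = pi" "clamped_angle (b\<^sup>2) (a\<^sup>2) (c\<^sup>2) = 0"
proof -
  have "(b + c)\<^sup>2 \<le> a\<^sup>2" using assms by (intro power_mono) auto
  hence "b\<^sup>2 + c\<^sup>2 - a\<^sup>2 \<le> - (2 * (b * c))"
    by (simp add: power2_sum)
  moreover have s: "sqrt (b\<^sup>2 * c\<^sup>2) = b * c" "sqrt (a\<^sup>2 * c\<^sup>2) = a * c"
    using assms by (simp_all add: real_sqrt_mult)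
  ultimately have "(b\<^sup>2 + c\<^sup>2 - a\<^sup>2) / (2 * sqrt (b\<^sup>2 * c\<^sup>2)) \<le> -1"
    using assms by (simp add: divide_le_eq)
  thus "clamped_angle (a\<^sup>2) (b\<^sup>2) (c\<^sup>2) = pi"
    unfolding clamped_angle_def by (simp add: max_def min_def)
  have "b\<^sup>2 \<le> (a - c)\<^sup>2" using assms by (intro power_mono) auto
  hence "2 * (a * c) \<le> a\<^sup>2 + c\<^sup>2 - b\<^sup>2"
    by (simp add: power2_diff)
  hence "1 \<le> (a\<^sup>2 + c\<^sup>2 - b\<^sup>2) / (2 * sqrt (a\<^sup>2 * c\<^sup>2))"
    unfolding s using assms by (simp add: le_divide_eq)
  thus "clamped_angle (b\<^sup>2) (a\<^sup>2) (c\<^sup>2) = 0"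
    unfolding clamped_angle_def by (simp add: max_def min_def)
qed

lemma cos_ratio_bounds:
  assumes "0 < B" "0 < C" "0 < heron A B C"
  shows "-1 < (B + C - A) / (2 * sqrt (B * C))" "(B + C - A) / (2 * sqrt (B * C)) < 1"
    "sqrt (1 - ((B + C - A) / (2 * sqrt (B * C)))\<^sup>2) = sqrt (heron A B C) / (2 * sqrt (B * C))"
proof -
  define r where "r = (B + C - A) / (2 * sqrt (B * C))"
  have sq: "1 - r\<^sup>2 = heron A B C / (2 * sqrt (B * C))\<^sup>2"
    using assms(1,2) by (simp add: r_def heron_eq field_simps)
  hence "0 < 1 - r\<^sup>2" using assms by simp
  hence "\<bar>r\<bar> < 1" using abs_square_less_1[of r] by simp
  thus "-1 < (B + C - A) / (2 * sqrt (B * C))" "(B + C - A) / (2 * sqrt (B * C)) < 1"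
    unfolding r_def by linarith+
  show "sqrt (1 - ((B + C - A) / (2 * sqrt (B * C)))\<^sup>2) = sqrt (heron A B C) / (2 * sqrt (B * C))"
    unfolding r_def[symmetric] sq using assms by (simp add: real_sqrt_divide real_sqrt_mult)
qed

lemma clamped_angle_nondegenerate:
  assumes "0 < B" "0 < C" "0 < heron A B C"
  shows "clamped_angle A B C = arccos ((B + C - A) / (2 * sqrt (B * C)))"
  using cos_ratio_bounds[OF assms] by (simp add: clamped_angle_def)

lemma clamped_angle_bounds:
  "0 \<le> clamped_angle A B C" "clamped_angle A B C \<le> pi"
  unfolding clamped_angle_def by (intro arccos_lbound arccos_ubound; simp)+

lemma continuous_on_clamped_angle [continuous_intros]:
  assumes "continuous_on S f" "continuous_on S g" "continuous_on S h"
    and "\<And>x. x \<in> S \<Longrightarrow> 0 < g x" "\<And>x. x \<in> S \<Longrightarrow> 0 < h x"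
  shows "continuous_on S (\<lambda>x. clamped_angle (f x) (g x) (h x))"
  unfolding clamped_angle_def
  by (intro continuous_intros assms)
     (use assms(4,5) in \<open>fastforce+\<close>)

text \<open>With \<open>a\<close>, \<open>b\<close>, \<open>c\<close> the derivatives of the logarithms of the three side lengths, the
  variation of an angle becomes polynomial in the squared lengths, apart from the common factor
  \<open>1 / sqrt heron\<close>.\<close>

lemma has_derivative_clamped_angle:
  fixes f g h :: "'a::real_normed_vector \<Rightarrow> real"
  assumes f: "(f has_derivative (\<lambda>v. 2 * f x * a v)) (at x)"
    and g: "(g has_derivative (\<lambda>v. 2 * g x * b v)) (at x)"
    and h: "(h has_derivative (\<lambda>v. 2 * h x * c v)) (at x)"
    and pos: "0 < g x" "0 < h x" "0 < heron (f x) (g x) (h x)"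
  shows "((\<lambda>y. clamped_angle (f y) (g y) (h y)) has_derivative
     (\<lambda>v. (2 * f x * a v - (f x + g x - h x) * b v - (f x + h x - g x) * c v)
          / sqrt (heron (f x) (g x) (h x)))) (at x)"
proof -
  define r where "r = (\<lambda>y. (g y + h y - f y) / (2 * sqrt (g y * h y)))"
  define r' where "r' = (\<lambda>v. - (2 * f x * a v - (f x + g x - h x) * b v
      - (f x + h x - g x) * c v) / (2 * sqrt (g x * h x)))"
  define m where "m = (\<lambda>y. sqrt (g y * h y))"
  have m: "0 < m x" "m x * m x = g x * h x" using pos by (simp_all add: m_def)
  have "(m has_derivative (\<lambda>v. (g x * (2 * h x * c v) + 2 * g x * b v * h x) *
            (inverse (sqrt (g x * h x)) / 2))) (at x)"
    unfolding m_def by (rule has_derivative_real_sqrt[OF _ has_derivative_mult[OF g h]]) (use pos in simp)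
  hence m': "(m has_derivative (\<lambda>v. m x * (b v + c v))) (at x)"
  proof (rule has_derivative_eq_rhs, intro ext)
    fix v
    have "(g x * (2 * h x * c v) + 2 * g x * b v * h x) * (inverse (m x) / 2)
        = (m x * m x) * (b v + c v) * inverse (m x)"
      unfolding m(2) by (simp add: algebra_simps)
    also have "\<dots> = m x * (b v + c v)" using m(1) by simp
    finally show "(g x * (2 * h x * c v) + 2 * g x * b v * h x) * (inverse (sqrt (g x * h x)) / 2)
        = m x * (b v + c v)" by (simp add: m_def)
  qed
  have r': "(r has_derivative r') (at x)"
  proof -
    have n': "((\<lambda>y. g y + h y - f y) has_derivative
        (\<lambda>v. 2 * g x * b v + 2 * h x * c v - 2 * f x * a v)) (at x)"
      by (intro has_derivative_diff has_derivative_add f g h)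
    have d': "((\<lambda>y. 2 * m y) has_derivative (\<lambda>v. 2 * (m x * (b v + c v)))) (at x)"
      by (intro has_derivative_mult_right m')
    have "((\<lambda>y. (g y + h y - f y) / (2 * m y)) has_derivative
       (\<lambda>v. ((2 * g x * b v + 2 * h x * c v - 2 * f x * a v) * (2 * m x)
             - (g x + h x - f x) * (2 * (m x * (b v + c v)))) / (2 * m x * (2 * m x)))) (at x)"
      by (rule has_derivative_divide'[OF n' d']) (use m in simp)
    moreover have mx: "sqrt (g x * h x) = m x" by (simp add: m_def)
    have "(\<lambda>v. ((2 * g x * b v + 2 * h x * c v - 2 * f x * a v) * (2 * m x)
             - (g x + h x - f x) * (2 * (m x * (b v + c v)))) / (2 * m x * (2 * m x))) = r'"
    proof
      fix v
      have "(2 * g x * b v + 2 * h x * c v - 2 * f x * a v) * (2 * m x)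
             - (g x + h x - f x) * (2 * (m x * (b v + c v)))
         = - (2 * f x * a v - (f x + g x - h x) * b v - (f x + h x - g x) * c v) * (2 * m x)"
        by algebra
      thus "((2 * g x * b v + 2 * h x * c v - 2 * f x * a v) * (2 * m x)
             - (g x + h x - f x) * (2 * (m x * (b v + c v)))) / (2 * m x * (2 * m x)) = r' v"
        using m(1) by (simp only: r'_def mx) (simp add: field_simps)
    qed
    ultimately show ?thesis unfolding r_def m_def by simp
  qed
  have rx: "-1 < r x" "r x < 1"
    and sr: "sqrt (1 - (r x)\<^sup>2) = sqrt (heron (f x) (g x) (h x)) / (2 * sqrt (g x * h x))"
    using cos_ratio_bounds[OF pos] by (simp_all add: r_def)
  have "isCont r x" using r' has_derivative_continuous by blast
  hence "\<forall>\<^sub>F y in at x. -1 < r y \<and> r y < 1"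
    using rx unfolding isCont_def by (intro eventually_conj) (auto dest: order_tendstoD)
  hence ev: "\<forall>\<^sub>F y in at x. clamped_angle (f y) (g y) (h y) = arccos (r y)"
    by eventually_elim (simp add: clamped_angle_def r_def)
  have "((\<lambda>y. arccos (r y)) has_derivative (\<lambda>v. inverse (- sqrt (1 - (r x)\<^sup>2)) * r' v)) (at x)"
    using has_derivative_compose[OF r' DERIV_arccos[OF rx, unfolded has_field_derivative_def]]
    by (simp add: mult.commute)
  hence *: "((\<lambda>y. clamped_angle (f y) (g y) (h y)) has_derivative
      (\<lambda>v. inverse (- sqrt (1 - (r x)\<^sup>2)) * r' v)) (at x)"
    by (rule has_derivative_transform_eventually)
      (use ev rx in \<open>auto elim!: eventually_mono simp: clamped_angle_def r_def\<close>)
  show ?thesis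
    by (rule has_derivative_eq_rhs[OF *])
      (use pos in \<open>simp add: fun_eq_iff sr r'_def field_simps\<close>)
qed

text \<open>In a nondegenerate triangle the addition theorem gives \<open>cos (\<alpha> + \<beta>) = - cos \<gamma>\<close>. This
  determines \<open>\<alpha> + \<beta>\<close> because \<open>\<alpha> + \<beta> < \<pi>\<close>, that is, \<open>cos \<alpha> + cos \<beta> > 0\<close>.\<close>

lemma clamped_angle_sum:
  assumes "0 < a" "0 < b" "0 < c"
  shows "clamped_angle (a\<^sup>2) (b\<^sup>2) (c\<^sup>2) + clamped_angle (b\<^sup>2) (c\<^sup>2) (a\<^sup>2)
         + clamped_angle (c\<^sup>2) (a\<^sup>2) (b\<^sup>2) = pi"
proof (cases "strict_triangle a b c")
  case False
  then consider "b + c \<le> a" | "a + c \<le> b" | "a + b \<le> c"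
    by (force simp: strict_triangle_def)
  thus ?thesis
    by cases (use assms degenerate_clamped_angles[of a b c] degenerate_clamped_angles[of a c b]
     degenerate_clamped_angles[of b a c] degenerate_clamped_angles[of b c a] degenerate_clamped_angles[of c a b] degenerate_clamped_angles[of c b a]
      in \<open>simp_all add: clamped_angle_commute add.commute\<close>)
next
  case True
  have H: "0 < heron (a\<^sup>2) (b\<^sup>2) (c\<^sup>2)"
    using True heron_pos_iff_strict_triangle assms by blast
  define x y z where "x = (b\<^sup>2 + c\<^sup>2 - a\<^sup>2) / (2 * sqrt (b\<^sup>2 * c\<^sup>2))"
    and "y = (c\<^sup>2 + a\<^sup>2 - b\<^sup>2) / (2 * sqrt (c\<^sup>2 * a\<^sup>2))"
    and "z = (a\<^sup>2 + b\<^sup>2 - c\<^sup>2) / (2 * sqrt (a\<^sup>2 * b\<^sup>2))"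
  note defs = x_def y_def z_def
  have H': "0 < heron (b\<^sup>2) (c\<^sup>2) (a\<^sup>2)" "0 < heron (c\<^sup>2) (a\<^sup>2) (b\<^sup>2)"
    using H by (simp_all add: heron_commute)
  have s: "sqrt (b\<^sup>2 * c\<^sup>2) = b * c" "sqrt (c\<^sup>2 * a\<^sup>2) = c * a" "sqrt (a\<^sup>2 * b\<^sup>2) = a * b"
    using assms by (simp_all add: real_sqrt_mult)
  have x: "-1 < x" "x < 1" "sqrt (1 - x\<^sup>2) = sqrt (heron (a\<^sup>2) (b\<^sup>2) (c\<^sup>2)) / (2 * (b * c))"
    unfolding x_def using cos_ratio_bounds[OF _ _ H] assms by (simp_all add: s)
  have y: "-1 < y" "y < 1" "sqrt (1 - y\<^sup>2) = sqrt (heron (a\<^sup>2) (b\<^sup>2) (c\<^sup>2)) / (2 * (c * a))"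
    unfolding y_def using cos_ratio_bounds[OF _ _ H'(1)] assms by (simp_all add: s heron_commute)
  have z: "-1 < z" "z < 1"
    unfolding z_def using cos_ratio_bounds[OF _ _ H'(2)] assms by (simp_all add: s heron_commute)
  \<comment> \<open>The numerator is positive by the triangle inequality for \<open>c\<close>.\<close>
  have "x + y = (a + b) * (c\<^sup>2 - (a - b)\<^sup>2) / (2 * a * b * c)"
    unfolding defs s using assms by (simp add: field_simps power2_eq_square)
  moreover have "(a - b)\<^sup>2 < c\<^sup>2"
    using True by (intro abs_le_square_iff[THEN iffD1] power2_strict_mono) (auto simp: strict_triangle_def)
  ultimately have "0 < x + y" using assms by simp
  hence "arccos y < arccos (- x)" using x y by (subst arccos_less_arccos) auto
  hence le: "arccos x + arccos y < pi" using x by (simp add: arccos_minus)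
  have "cos (arccos x + arccos y) = x * y - sqrt (1 - x\<^sup>2) * sqrt (1 - y\<^sup>2)"
    using x y by (simp add: cos_add cos_arccos sin_arccos)
  also have "sqrt (1 - x\<^sup>2) * sqrt (1 - y\<^sup>2) = heron (a\<^sup>2) (b\<^sup>2) (c\<^sup>2) / (4 * a * b * c\<^sup>2)"
    unfolding x(3) y(3) using H by (simp add: power2_eq_square)
  also have "x * y - heron (a\<^sup>2) (b\<^sup>2) (c\<^sup>2) / (4 * a * b * c\<^sup>2) = - z"
    unfolding defs s heron_def using assms
    by (simp add: field_simps power2_eq_square)
  finally have "arccos x + arccos y = arccos (- z)"
    using le x y by (metis add_nonneg_nonneg arccos_cos arccos_lbound less_imp_le)
  hence "arccos x + arccos y + arccos z = pi" using z by (simp add: arccos_minus)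
  thus ?thesis using assms H H'
    by (simp add: clamped_angle_nondegenerate defs)
qed

section \<open>The quadratic form of the angle variation\<close>

text \<open>Completing the square: the form depends only on the differences of \<open>x\<close>, \<open>y\<close>, \<open>z\<close>, hence
  is a binary form with leading coefficient \<open>f + g\<close> and determinant \<open>f g + g h + h f\<close>. Single
  weights may be negative.\<close>

lemma three_edge_form_definite:
  fixes f g h x y z :: real
  assumes "0 < f + g" and D: "0 < f * g + g * h + h * f"
  shows "0 \<le> f * (x - y)\<^sup>2 + g * (z - x)\<^sup>2 + h * (y - z)\<^sup>2"
    and "f * (x - y)\<^sup>2 + g * (z - x)\<^sup>2 + h * (y - z)\<^sup>2 = 0 \<Longrightarrow> x = y \<and> y = z"
proof -
  let ?P = "f * (x - y)\<^sup>2 + g * (z - x)\<^sup>2 + h * (y - z)\<^sup>2"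
  have eq: "(f + g) * ?P =
      (f * (x - y) + g * (x - z))\<^sup>2 + (f * g + g * h + h * f) * (y - z)\<^sup>2"
    by (simp add: power2_eq_square algebra_simps)
  hence "0 \<le> (f + g) * ?P" using D by simp
  thus "0 \<le> ?P" using assms(1) by (simp add: zero_le_mult_iff)
  assume "?P = 0"
  hence 0: "(f * (x - y) + g * (x - z))\<^sup>2 + (f * g + g * h + h * f) * (y - z)\<^sup>2 = 0"
    using eq by simp
  have n: "0 \<le> (f * (x - y) + g * (x - z))\<^sup>2" "0 \<le> (f * g + g * h + h * f) * (y - z)\<^sup>2"
    using D by simp_all
  have 1: "(f * (x - y) + g * (x - z))\<^sup>2 = 0" "(f * g + g * h + h * f) * (y - z)\<^sup>2 = 0"
    using 0 n by linarith+
  hence yz: "y = z" using D by simp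
  have "f * (x - z) + g * (x - z) = 0" using 1(1) unfolding yz by simp
  hence "(f + g) * (x - z) = 0" by (simp only: distrib_right)
  thus "x = y \<and> y = z" using yz assms(1) by simp
qed

text \<open>Let \<open>A\<close>, \<open>B\<close>, \<open>C\<close> be the squared lengths of the sides \<open>jk\<close>, \<open>ki\<close>, \<open>ij\<close>, and let \<open>q\<close>, \<open>t\<close>,
  \<open>p\<close> mark points on these sides as fractions measured from \<open>j\<close>, \<open>k\<close>, \<open>i\<close>. The hypothesis is
  Carnot's condition that the perpendiculars at the three points are concurrent. The factor \<open>p
  q t + (1 - p) (1 - q) (1 - t)\<close> is the ratio of the area of the pedal triangle to that of the
  triangle; it is positive if the points are interior to the sides. The weights \<open>f\<close>, \<open>g\<close>, \<open>h\<close>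
  of the sides \<open>ij\<close>, \<open>ki\<close>, \<open>jk\<close> are \<open>sqrt heron\<close> times the derivatives of the angle at one end
  with respect to the logarithmic radius at the other end.\<close>

lemma pedal_identity:
  fixes A B C p q t :: real
  assumes "A * (2*q - 1) + B * (2*t - 1) + C * (2*p - 1) = 0" "C > 0"
  defines "f \<equiv> 2*A*q - (A + C - B) * (1 - p)"
      and "g \<equiv> 2*A*(1 - q) - (A + B - C) * t"
      and "h \<equiv> 2*B*t - (B + A - C) * (1 - q)"
  shows "f * g + g * h + h * f = heron A B C * (p * q * t + (1 - p) * (1 - q) * (1 - t))"
proof -
  have p: "p = (C - A * (2*q - 1) - B * (2*t - 1)) / (2 * C)" using assms(1,2)
    by (simp add: field_simps)
  show ?thesis unfolding f_def g_def h_def heron_def p using assms(2)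
    by (simp add: field_simps power2_eq_square)
qed

text \<open>Carnot's condition makes the Jacobian of the three angles symmetric, and its rows sum to
  0 since scaling preserves angles. So its quadratic form is determined by the off-diagonal
  entries.\<close>

lemma angle_variation_eq_edge_form:
  fixes A B C p q t x y z :: real
  assumes "A * (2*q - 1) + B * (2*t - 1) + C * (2*p - 1) = 0"
  defines "f \<equiv> 2*A*q - (A + C - B) * (1 - p)"
      and "g \<equiv> 2*A*(1 - q) - (A + B - C) * t"
      and "h \<equiv> 2*B*t - (B + A - C) * (1 - q)"
  defines "a \<equiv> q * y + (1 - q) * z"
      and "b \<equiv> t * z + (1 - t) * x"
      and "c \<equiv> p * x + (1 - p) * y"
    shows "x * (2*A*a - (A + B - C) * b - (A + C - B) * c)
     + y * (2*B*b - (B + C - A) * c - (B + A - C) * a)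
     + z * (2*C*c - (C + A - B) * a - (C + B - A) * b)
     = - (f * (x - y)\<^sup>2 + g * (z - x)\<^sup>2 + h * (y - z)\<^sup>2)"
  using assms(1) unfolding f_def g_def h_def a_def b_def c_def
  by algebra


text \<open>The determinant of the form is positive by the pedal identity. For a definite sign one
  positive diagonal entry is enough: it is found at the vertex opposite to the longest side,
  where the angles at the other two vertices are acute.\<close>

lemma angle_variation_negative:
  fixes A B C p q t x y z :: real
  assumes pos: "0 < A" "0 < B" "0 < C" and heron: "0 < heron A B C"
    and e: "A * (2*q - 1) + B * (2*t - 1) + C * (2*p - 1) = 0"
    and p: "0 < p" "p < 1" and q: "0 < q" "q < 1" and t: "0 < t" "t < 1"
  defines "a \<equiv> q * y + (1 - q) * z"
      and "b \<equiv> t * z + (1 - t) * x"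
      and "c \<equiv> p * x + (1 - p) * y"
  defines "S \<equiv> x * (2*A*a - (A + B - C) * b - (A + C - B) * c)
     + y * (2*B*b - (B + C - A) * c - (B + A - C) * a)
     + z * (2*C*c - (C + A - B) * a - (C + B - A) * b)"
  shows "S \<le> 0" and "S = 0 \<Longrightarrow> x = y \<and> y = z"
proof -
  define f where "f = 2*A*q - (A + C - B) * (1 - p)"
  define g where "g = 2*A*(1 - q) - (A + B - C) * t"
  define h where "h = 2*B*t - (B + A - C) * (1 - q)"
  have S: "S = - (f * (x - y)\<^sup>2 + g * (z - x)\<^sup>2 + h * (y - z)\<^sup>2)"
    unfolding S_def a_def b_def c_def f_def g_def h_def by (rule angle_variation_eq_edge_form[OF e])
  have "0 < p * q * t + (1 - p) * (1 - q) * (1 - t)"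
    using p q t by (intro add_pos_pos mult_pos_pos) auto
  hence D: "0 < f * g + g * h + h * f"
    using pedal_identity[OF e pos(3)] heron unfolding f_def g_def h_def by simp
  have fg: "f + g = (A + B - C) * (1 - t) + (A + C - B) * p"
    unfolding f_def g_def by algebra
  have hf: "h + f = (B + C - A) * (1 - p) + (B + A - C) * q"
    using e unfolding f_def h_def by algebra
  have gh: "g + h = (C + A - B) * (1 - q) + (C + B - A) * t"
    unfolding g_def h_def by algebra
  consider "B \<le> A" "C \<le> A" | "A \<le> B" "C \<le> B" | "A \<le> C" "B \<le> C" by linarith
  hence "0 \<le> f * (x - y)\<^sup>2 + g * (z - x)\<^sup>2 + h * (y - z)\<^sup>2 \<and>
     (f * (x - y)\<^sup>2 + g * (z - x)\<^sup>2 + h * (y - z)\<^sup>2 = 0 \<longrightarrow> x = y \<and> y = z)"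
  proof cases
    case 1
    hence "0 < f + g" unfolding fg using pos p t by (intro add_pos_pos mult_pos_pos) auto
    from three_edge_form_definite[OF this D] show ?thesis by blast
  next
    case 2
    hence "0 < h + f" unfolding hf using pos p q by (intro add_pos_pos mult_pos_pos) auto
    from three_edge_form_definite[OF this, of g y z x] D show ?thesis by (auto simp: algebra_simps)
  next
    case 3
    hence "0 < g + h" unfolding gh using pos q t by (intro add_pos_pos mult_pos_pos) auto
    from three_edge_form_definite[OF this, of f z x y] D show ?thesis by (auto simp: algebra_simps)
  qed
  thus "S \<le> 0" and "S = 0 \<Longrightarrow> x = y \<and> y = z" unfolding S by auto
qed

section \<open>Angles of a face as functions of logarithmic radii\<close>

definition sq_length :: "('v set \<Rightarrow> real) \<Rightarrow> real^'v \<Rightarrow> 'v::finite \<Rightarrow> 'v \<Rightarrow> real" where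
  "sq_length I u i j = (exp (u $ i))\<^sup>2 + (exp (u $ j))\<^sup>2 + 2 * exp (u $ i) * exp (u $ j) * I {i, j}"

text \<open>The position of the foot of the perpendicular from the power centre of the vertex circles
  to the edge, as a fraction of the edge measured from \<open>i\<close>; equivalently the derivative of the
  logarithm of the edge length with respect to \<open>u\<^sub>i\<close>.\<close>

definition foot :: "('v set \<Rightarrow> real) \<Rightarrow> real^'v \<Rightarrow> 'v::finite \<Rightarrow> 'v \<Rightarrow> real" where
  "foot I u i j = ((exp (u $ i))\<^sup>2 + exp (u $ i) * exp (u $ j) * I {i, j}) / sq_length I u i j"

lemma sq_length_commute: "sq_length I u j i = sq_length I u i j"
  by (simp add: sq_length_def insert_commute mult_ac)

lemma edge_length_exp_vec: "edge_length I (exp_vec u) i j = sqrt (sq_length I u i j)"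
  by (simp add: edge_length_def exp_vec_def sq_length_def)

lemma sq_length_pos:
  assumes "0 \<le> I {i, j}"
  shows "0 < sq_length I u i j"
  unfolding sq_length_def using assms by (intro add_pos_nonneg add_pos_pos) auto

lemma foot_bounds:
  assumes "0 \<le> I {i, j}"
  shows "0 < foot I u i j" "foot I u i j < 1"
proof -
  have *: "0 \<le> exp (u $ i) * exp (u $ j) * I {i, j}" using assms by simp
  have "0 < (exp (u $ i))\<^sup>2 + exp (u $ i) * exp (u $ j) * I {i, j}"
    "0 < (exp (u $ j))\<^sup>2 + exp (u $ i) * exp (u $ j) * I {i, j}"
    using * by (intro add_pos_nonneg; simp)+
  thus "0 < foot I u i j" "foot I u i j < 1"
    using sq_length_pos[of I i j u, OF assms] by (simp_all add: foot_def sq_length_def)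
qed

lemma sq_length_times_foot:
  assumes "0 \<le> I {i, j}"
  shows "sq_length I u i j * foot I u i j = (exp (u $ i))\<^sup>2 + exp (u $ i) * exp (u $ j) * I {i, j}"
    and "sq_length I u i j * (1 - foot I u i j) = (exp (u $ j))\<^sup>2 + exp (u $ i) * exp (u $ j) * I {i, j}"
    and "sq_length I u i j * (2 * foot I u i j - 1) = (exp (u $ i))\<^sup>2 - (exp (u $ j))\<^sup>2"
proof -
  show 1: "sq_length I u i j * foot I u i j = (exp (u $ i))\<^sup>2 + exp (u $ i) * exp (u $ j) * I {i, j}"
    using sq_length_pos[of I i j u, OF assms] by (simp add: foot_def)
  have L: "sq_length I u i j = (exp (u $ i))\<^sup>2 + (exp (u $ j))\<^sup>2 + 2 * (exp (u $ i) * exp (u $ j) * I {i, j})"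
    by (simp add: sq_length_def)
  show "sq_length I u i j * (1 - foot I u i j) = (exp (u $ j))\<^sup>2 + exp (u $ i) * exp (u $ j) * I {i, j}"
    unfolding right_diff_distrib 1 using L by linarith
  have "sq_length I u i j * (2 * foot I u i j - 1) = 2 * (sq_length I u i j * foot I u i j) - sq_length I u i j"
    by (simp add: right_diff_distrib)
  also have "\<dots> = (exp (u $ i))\<^sup>2 - (exp (u $ j))\<^sup>2"
    unfolding 1 unfolding L by simp
  finally show "sq_length I u i j * (2 * foot I u i j - 1) = (exp (u $ i))\<^sup>2 - (exp (u $ j))\<^sup>2" .
qed

lemma has_derivative_sq_length:
  assumes "0 \<le> I {i, j}"
  shows "((\<lambda>u. sq_length I u i j) has_derivative
    (\<lambda>v. 2 * sq_length I u i j * (foot I u i j * v $ i + (1 - foot I u i j) * v $ j))) (at u)"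
proof -
  have nth: "((\<lambda>u. u $ m) has_derivative (\<lambda>v. v $ m)) (at u)" for m
    by (rule bounded_linear_imp_has_derivative) (rule bounded_linear_vec_nth)
  define a b c where "a = exp (u $ i)" and "b = exp (u $ j)" and "c = I {i, j}"
  have E: "((\<lambda>u. exp (u $ m)) has_derivative (\<lambda>v. v $ m * exp (u $ m))) (at u)" for m
    using has_derivative_exp[OF nth[of m]] by (simp add: mult.commute)
  have "((\<lambda>u. sq_length I u i j) has_derivative
     (\<lambda>v. 2 * (v $ i * a) * a + 2 * (v $ j * b) * b + 2 * (v $ i * a * b + a * (v $ j * b)) * c)) (at u)"
    unfolding sq_length_def a_def b_def c_def
    by (rule derivative_eq_intros E refl | simp add: fun_eq_iff algebra_simps)+
  moreover have "2 * (v $ i * a) * a + 2 * (v $ j * b) * b + 2 * (v $ i * a * b + a * (v $ j * b)) * c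
     = 2 * sq_length I u i j * (foot I u i j * v $ i + (1 - foot I u i j) * v $ j)" for v
  proof -
    have 1: "sq_length I u i j * foot I u i j = a\<^sup>2 + a * b * c"
      unfolding a_def b_def c_def by (rule sq_length_times_foot(1)[of I i j u, OF assms])
    have 2: "sq_length I u i j * (1 - foot I u i j) = b\<^sup>2 + a * b * c"
      unfolding a_def b_def c_def by (rule sq_length_times_foot(2)[of I i j u, OF assms])
    have "2 * sq_length I u i j * (foot I u i j * v $ i + (1 - foot I u i j) * v $ j)
        = 2 * (sq_length I u i j * foot I u i j) * v $ i + 2 * (sq_length I u i j * (1 - foot I u i j)) * v $ j"
      by (simp only: distrib_left mult.assoc)
    thus ?thesis unfolding 1 2 by (simp add: power2_eq_square algebra_simps)
  qed
  ultimately show ?thesis by simp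
qed

definition face_angle :: "('v set \<Rightarrow> real) \<Rightarrow> real^'v \<Rightarrow> 'v::finite \<Rightarrow> 'v \<Rightarrow> 'v \<Rightarrow> real" where
  "face_angle I u i j k =
     clamped_angle (sq_length I u j k) (sq_length I u k i) (sq_length I u i j)"

lemma face_angle_commute: "face_angle I u i k j = face_angle I u i j k"
  by (simp add: face_angle_def clamped_angle_commute[of "sq_length I u j k"] sq_length_commute)

lemma gen_theta_eq_face_angle:
  assumes "0 \<le> I {i, j}" "0 \<le> I {j, k}" "0 \<le> I {k, i}"
  shows "gen_theta I (exp_vec u) i j k = face_angle I u i j k"
proof -
  define a b c where "a = edge_length I (exp_vec u) j k" and "b = edge_length I (exp_vec u) i k"
    and "c = edge_length I (exp_vec u) i j"
  have "0 < sq_length I u j k" "0 < sq_length I u i k" "0 < sq_length I u i j"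
    using assms by (auto intro!: sq_length_pos simp: insert_commute)
  hence pos: "0 < a" "0 < b" "0 < c" and sq: "sq_length I u j k = a\<^sup>2"
      "sq_length I u k i = b\<^sup>2" "sq_length I u i j = c\<^sup>2"
    by (simp_all add: a_def b_def c_def edge_length_exp_vec sq_length_commute[of I u k i])
  have fa: "face_angle I u i j k = clamped_angle (a\<^sup>2) (b\<^sup>2) (c\<^sup>2)"
    by (simp add: face_angle_def sq)
  show ?thesis
  proof (cases "strict_triangle a b c")
    case True
    hence "strict_triangle a c b" by (auto simp: strict_triangle_def)
    hence "gen_theta I (exp_vec u) i j k = triangle_angle a c b"
      by (simp add: gen_theta_def theta_def a_def b_def c_def)
    also have "\<dots> = arccos ((c\<^sup>2 + b\<^sup>2 - a\<^sup>2) / (2 * c * b))"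
      by (rule triangle_angle_law_of_cosines) (use pos \<open>strict_triangle a c b\<close> in auto)
    also have "\<dots> = clamped_angle (a\<^sup>2) (b\<^sup>2) (c\<^sup>2)"
      using True heron_pos_iff_strict_triangle[OF pos] pos
      by (simp add: clamped_angle_nondegenerate real_sqrt_mult mult_ac add.commute)
    finally show ?thesis unfolding fa .
  next
    case False
    hence ns: "\<not> strict_triangle a c b" by (auto simp: strict_triangle_def)
    hence gt: "gen_theta I (exp_vec u) i j k = (if c + b \<le> a then pi else 0)"
      by (simp add: gen_theta_def a_def b_def c_def)
    consider "b + c \<le> a" | "\<not> b + c \<le> a" "a + c \<le> b" | "\<not> b + c \<le> a" "a + b \<le> c"
      using False by (force simp: strict_triangle_def)
    thus ?thesis
    proof cases
      case 1
      thus ?thesis unfolding gt fa using degenerate_clamped_angles(1)[OF pos] by simp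
    next
      case 2
      thus ?thesis unfolding gt fa using degenerate_clamped_angles(2)[of b a c] pos by simp
    next
      case 3
      thus ?thesis unfolding gt fa using degenerate_clamped_angles(2)[of c a b] pos
        by (simp add: clamped_angle_commute[of "a\<^sup>2"])
    qed
  qed
qed


text \<open>Suppose that \<open>f a < f b\<close>. Some interval \<open>[y0, y1]\<close> of values strictly between \<open>f a\<close> and
  \<open>f b\<close> avoids \<open>S\<close>. Take the first time \<open>t1\<close> at which \<open>f\<close> reaches \<open>y1\<close> and the last time \<open>t0\<close>
  before it with value \<open>y0\<close>. In between, \<open>f\<close> stays in the interval, so its derivative is
  nonpositive although it has to rise from \<open>y0\<close> to \<open>y1\<close>.\<close>

lemma nonincreasing_off_finite_values:
  fixes f :: "real \<Rightarrow> real"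
  assumes "a \<le> b" and cont: "continuous_on {a..b} f" and S: "finite S"
    and der: "\<And>t. t \<in> {a..b} \<Longrightarrow> f t \<notin> S \<Longrightarrow> \<exists>d\<le>0. (f has_real_derivative d) (at t)"
  shows "f b \<le> f a"
proof (rule ccontr)
  assume "\<not> f b \<le> f a"
  hence less: "f a < f b" by simp
  have "infinite ({f a<..<f b} - S)" using less S by (simp add: infinite_Ioo)
  then obtain y where y: "y \<in> {f a<..<f b} - S" using infinite_imp_nonempty by blast
  have "open ({f a<..<f b} - S)" using S by (intro open_Diff finite_imp_closed) auto
  then obtain e where e: "0 < e" "cball y e \<subseteq> {f a<..<f b} - S"
    using y open_contains_cball by blast
  define y0 y1 where "y0 = y - e" and "y1 = y + e"
  have yy: "y0 < y1" "f a < y0" "y1 < f b"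
    and avoid: "\<And>x. y0 \<le> x \<Longrightarrow> x \<le> y1 \<Longrightarrow> x \<notin> S"
    using e(1) subsetD[OF e(2), of "y - e"] subsetD[OF e(2), of "y + e"] subsetD[OF e(2)]
    by (auto simp: y0_def y1_def dist_real_def)
  define T1 where "T1 = {t \<in> {a..b}. f t = y1}"
  have "compact T1" unfolding T1_def compact_eq_bounded_closed
    using continuous_closed_preimage_constant[OF cont closed_atLeastAtMost]
    by (auto intro: bounded_subset[OF bounded_closed_interval[of a b]])
  moreover have "\<exists>t\<ge>a. t \<le> b \<and> f t = y1"
    by (rule IVT') (use yy assms(1) cont in auto)
  hence "T1 \<noteq> {}" by (auto simp: T1_def)
  ultimately obtain t1 where t1: "t1 \<in> T1" "\<And>t. t \<in> T1 \<Longrightarrow> t1 \<le> t"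
    using compact_attains_inf by metis
  have t1': "a \<le> t1" "t1 \<le> b" "f t1 = y1" using t1 by (auto simp: T1_def)
  have cont1: "continuous_on {a..t1} f" by (rule continuous_on_subset[OF cont]) (use t1' in auto)
  define T0 where "T0 = {t \<in> {a..t1}. f t = y0}"
  have "compact T0" unfolding T0_def compact_eq_bounded_closed
    using continuous_closed_preimage_constant[OF cont1 closed_atLeastAtMost]
    by (auto intro: bounded_subset[OF bounded_closed_interval[of a t1]])
  moreover have "\<exists>t\<ge>a. t \<le> t1 \<and> f t = y0"
    by (rule IVT') (use yy t1' cont1 in auto)
  hence "T0 \<noteq> {}" by (auto simp: T0_def)
  ultimately obtain t0 where t0: "t0 \<in> T0" "\<And>t. t \<in> T0 \<Longrightarrow> t \<le> t0"
    using compact_attains_sup by metis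
  have t0': "a \<le> t0" "t0 \<le> t1" "f t0 = y0" using t0 by (auto simp: T0_def)
  have lt: "t0 < t1" using t0' t1' yy by (cases "t0 = t1") auto
  have between: "f t \<notin> S" if t: "t \<in> {t0..t1}" for t
  proof (rule avoid)
    show "y0 \<le> f t"
    proof (rule ccontr)
      assume *: "\<not> y0 \<le> f t"
      have "\<exists>s\<ge>t. s \<le> t1 \<and> f s = y0"
        by (rule IVT') (use * t t0' t1' yy in \<open>auto intro!: continuous_on_subset[OF cont]\<close>)
      then obtain s where s: "t \<le> s" "s \<le> t1" "f s = y0" by blast
      hence "s \<le> t0" using t t0' by (intro t0(2)) (auto simp: T0_def)
      thus False using s t t0' * by (cases "s = t") auto
    qed
    show "f t \<le> y1"
    proof (rule ccontr)
      assume *: "\<not> f t \<le> y1"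
      have "\<exists>s\<ge>a. s \<le> t \<and> f s = y1"
        by (rule IVT') (use * t t0' t1' yy in \<open>auto intro!: continuous_on_subset[OF cont]\<close>)
      then obtain s where s: "a \<le> s" "s \<le> t" "f s = y1" by blast
      hence "t1 \<le> s" using t t1' by (intro t1(2)) (auto simp: T1_def)
      thus False using s t t1' * by (cases "s = t") auto
    qed
  qed
  have "f t1 \<le> f t0"
  proof (rule DERIV_nonpos_imp_nonincreasing[where f = f])
    show "t0 \<le> t1" using lt by simp
    fix t assume t: "t0 \<le> t" "t \<le> t1"
    hence "f t \<notin> S" using between[of t] by simp
    moreover have "t \<in> {a..b}" using t t0' t1' by simp
    ultimately show "\<exists>y. (f has_real_derivative y) (at t) \<and> y \<le> 0" using der[of t] by blast
  qed
  thus False using t0' t1' yy by simp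
qed

definition angle_at :: "('v set \<Rightarrow> real) \<Rightarrow> 'v set \<Rightarrow> real^'v \<Rightarrow> 'v::finite \<Rightarrow> real" where
  "angle_at I f u i = angle_in_face (gen_theta I (exp_vec u)) i f"

text \<open>Quantifying over all labellings of the vertices makes this a property of the face; the
  Heron expression does not depend on the labelling (\<open>nondegenerate_iff\<close>).\<close>

definition nondegenerate :: "('v set \<Rightarrow> real) \<Rightarrow> real^'v \<Rightarrow> 'v::finite set \<Rightarrow> bool" where
  "nondegenerate I u f \<longleftrightarrow> (\<forall>i j k. f = {i, j, k} \<longrightarrow>
     0 < heron (sq_length I u j k) (sq_length I u k i) (sq_length I u i j))"

locale weighted_faces =
  fixes F :: "'v::finite set set" and I :: "'v set \<Rightarrow> real"
  assumes card_face: "f \<in> F \<Longrightarrow> card f = 3"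
    and weight_nonneg: "f \<in> F \<Longrightarrow> e \<subseteq> f \<Longrightarrow> card e = 2 \<Longrightarrow> 0 \<le> I e"
begin

lemma face_distinct:
  assumes "{i, j, k} \<in> F"
  shows "i \<noteq> j" "j \<noteq> k" "k \<noteq> i"
  using card_face[OF assms] by (auto simp: card_insert_if split: if_splits)

lemma face_weights:
  assumes "{i, j, k} \<in> F"
  shows "0 \<le> I {i, j}" "0 \<le> I {j, k}" "0 \<le> I {k, i}"
  using face_distinct[OF assms] by (auto intro!: weight_nonneg[OF assms])

lemma face_cases:
  assumes "f \<in> F"
  obtains i j k where "f = {i, j, k}" "{i, j, k} \<in> F" "i \<noteq> j" "j \<noteq> k" "k \<noteq> i"
  using card_face[OF assms] assms by (auto simp: card_3_iff)

lemma angle_at_eq: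
  assumes "{i, j, k} \<in> F"
  shows "angle_at I {i, j, k} u i = face_angle I u i j k"
proof -
  have g: "gen_theta I (exp_vec u) i j k = face_angle I u i j k"
    using face_weights[OF assms] by (intro gen_theta_eq_face_angle)
  have g': "gen_theta I (exp_vec u) i k j = face_angle I u i k j"
    using face_weights[OF assms] by (intro gen_theta_eq_face_angle) (auto simp: insert_commute)
  show ?thesis unfolding angle_at_def
    using angle_in_face_eq[OF card_face[OF assms], of "gen_theta I (exp_vec u)"] g g'
    by (simp add: face_angle_commute)
qed

lemma angles_at:
  assumes "{i, j, k} \<in> F"
  shows "angle_at I {i, j, k} u i = face_angle I u i j k"
    "angle_at I {i, j, k} u j = face_angle I u j k i"
    "angle_at I {i, j, k} u k = face_angle I u k i j"
proof -
  have p: "{i, j, k} = {j, k, i}" "{i, j, k} = {k, i, j}" by auto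
  show "angle_at I {i, j, k} u i = face_angle I u i j k" by (rule angle_at_eq[OF assms])
  show "angle_at I {i, j, k} u j = face_angle I u j k i"
    using angle_at_eq[of j k i u] assms p(1) by metis
  show "angle_at I {i, j, k} u k = face_angle I u k i j"
    using angle_at_eq[of k i j u] assms p(2) by metis
qed

lemma sq_lengths_pos:
  assumes "{i, j, k} \<in> F"
  shows "0 < sq_length I u i j" "0 < sq_length I u j k" "0 < sq_length I u k i"
  using face_weights[OF assms] by (auto intro: sq_length_pos)

lemma sum_face:
  assumes "{i, j, k} \<in> F"
  shows "(\<Sum>m\<in>{i, j, k}. g m) = g i + g j + (g k :: real)"
  using face_distinct[OF assms] by auto

lemma nondegenerate_iff:
  assumes "{i, j, k} \<in> F"
  shows "nondegenerate I u {i, j, k} \<longleftrightarrow>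
     0 < heron (sq_length I u j k) (sq_length I u k i) (sq_length I u i j)"
proof -
  have same: "heron (sq_length I u y z) (sq_length I u z x) (sq_length I u x y)
      = heron (sq_length I u j k) (sq_length I u k i) (sq_length I u i j)"
    if eq: "{i, j, k} = {x, y, z}" for x y z
  proof -
    have "x \<noteq> y" "y \<noteq> z" "z \<noteq> x" using face_distinct[of x y z] assms eq by auto
    moreover have "x \<in> {i, j, k}" "y \<in> {i, j, k}" "z \<in> {i, j, k}" unfolding eq by auto
    ultimately consider "x = i" "y = j" "z = k" | "x = j" "y = k" "z = i" | "x = k" "y = i" "z = j"
      | "x = i" "y = k" "z = j" | "x = j" "y = i" "z = k" | "x = k" "y = j" "z = i"
      by auto
    thus ?thesis
      by cases (simp_all add: sq_length_commute[of I u j i] sq_length_commute[of I u k j]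
         sq_length_commute[of I u i k] heron_def)
  qed
  show ?thesis
  proof
    assume "nondegenerate I u {i, j, k}"
    thus "0 < heron (sq_length I u j k) (sq_length I u k i) (sq_length I u i j)"
      unfolding nondegenerate_def by simp
  next
    assume *: "0 < heron (sq_length I u j k) (sq_length I u k i) (sq_length I u i j)"
    show "nondegenerate I u {i, j, k}"
      unfolding nondegenerate_def
    proof (intro allI impI)
      fix x y z assume "{i, j, k} = {x, y, z}"
      from same[OF this] * show "0 < heron (sq_length I u y z) (sq_length I u z x) (sq_length I u x y)"
        by simp
    qed
  qed
qed

lemma angle_at_bounds:
  assumes "f \<in> F" "i \<in> f"
  shows "0 \<le> angle_at I f u i" "angle_at I f u i \<le> pi"
proof -
  from face_cases[OF assms(1)] obtain a b c where f: "f = {a, b, c}" "{a, b, c} \<in> F" by metis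
  show "0 \<le> angle_at I f u i" "angle_at I f u i \<le> pi"
    using assms(2) angles_at[OF f(2)] clamped_angle_bounds unfolding f(1) face_angle_def by auto
qed

lemma continuous_on_angle_at:
  assumes "f \<in> F" "i \<in> f"
  shows "continuous_on S (\<lambda>u. angle_at I f u i)"
proof -
  from face_cases[OF assms(1)] obtain a b c where f: "f = {a, b, c}" "{a, b, c} \<in> F" by metis
  have c: "continuous_on S (\<lambda>u. sq_length I u m n)" for m n
    unfolding sq_length_def by (intro continuous_intros)
  have "continuous_on S (\<lambda>u. face_angle I u a b c)" "continuous_on S (\<lambda>u. face_angle I u b c a)"
    "continuous_on S (\<lambda>u. face_angle I u c a b)"
    unfolding face_angle_def using sq_lengths_pos[OF f(2)] by (auto intro!: continuous_on_clamped_angle c)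
  thus ?thesis using assms(2) angles_at[OF f(2)] unfolding f(1) by auto
qed

lemma angle_at_sum:
  assumes "f \<in> F"
  shows "(\<Sum>i\<in>f. angle_at I f u i) = pi"
proof -
  from face_cases[OF assms(1)] obtain i j k where f: "f = {i, j, k}" "{i, j, k} \<in> F" by metis
  have "face_angle I u i j k + face_angle I u j k i + face_angle I u k i j = pi"
    using clamped_angle_sum[of "sqrt (sq_length I u j k)" "sqrt (sq_length I u k i)" "sqrt (sq_length I u i j)"]
      sq_lengths_pos[OF f(2), of u] by (simp add: face_angle_def)
  thus ?thesis unfolding f(1) sum_face[OF f(2)] angles_at[OF f(2)] .
qed

text \<open>A degenerate face has one angle \<open>\<pi>\<close> and two angles 0, so a weighted angle sum can take
  only three values, whatever the radii. This is what keeps the degenerate set from interfering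
  with monotonicity.\<close>

lemma degenerate_angles:
  assumes "f \<in> F" "\<not> nondegenerate I u f"
  shows "(\<Sum>i\<in>f. w $ i * angle_at I f u i) \<in> (\<lambda>i. w $ i * pi) ` f"
proof -
  from face_cases[OF assms(1)] obtain i j k where f: "f = {i, j, k}" "{i, j, k} \<in> F" by metis
  define a b c where "a = sqrt (sq_length I u j k)" and "b = sqrt (sq_length I u k i)"
    and "c = sqrt (sq_length I u i j)"
  have pos: "0 < a" "0 < b" "0 < c"
    and sq: "sq_length I u j k = a\<^sup>2" "sq_length I u k i = b\<^sup>2" "sq_length I u i j = c\<^sup>2"
    using sq_lengths_pos[OF f(2), of u] by (simp_all add: a_def b_def c_def)
  have "\<not> strict_triangle a b c"
    using assms(2) heron_pos_iff_strict_triangle[OF pos] unfolding f(1) nondegenerate_iff[OF f(2)] sq by simp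
  then consider "b + c \<le> a" | "c + a \<le> b" | "a + b \<le> c" by (force simp: strict_triangle_def)
  thus ?thesis unfolding f(1) sum_face[OF f(2)] angles_at[OF f(2)] face_angle_def sq
  proof cases
    case 1
    thus "w $ i * clamped_angle (a\<^sup>2) (b\<^sup>2) (c\<^sup>2) + w $ j * clamped_angle (b\<^sup>2) (c\<^sup>2) (a\<^sup>2) +
        w $ k * clamped_angle (c\<^sup>2) (a\<^sup>2) (b\<^sup>2) \<in> (\<lambda>i. w $ i * pi) ` {i, j, k}"
      using degenerate_clamped_angles[of a b c] degenerate_clamped_angles[of a c b] pos
      by (simp add: clamped_angle_commute[of "b\<^sup>2" "c\<^sup>2"] add.commute)
  next
    case 2
    thus "w $ i * clamped_angle (a\<^sup>2) (b\<^sup>2) (c\<^sup>2) + w $ j * clamped_angle (b\<^sup>2) (c\<^sup>2) (a\<^sup>2) +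
        w $ k * clamped_angle (c\<^sup>2) (a\<^sup>2) (b\<^sup>2) \<in> (\<lambda>i. w $ i * pi) ` {i, j, k}"
      using degenerate_clamped_angles[of b c a] degenerate_clamped_angles[of b a c] pos
      by (simp add: clamped_angle_commute[of "c\<^sup>2" "a\<^sup>2"] add.commute)
  next
    case 3
    thus "w $ i * clamped_angle (a\<^sup>2) (b\<^sup>2) (c\<^sup>2) + w $ j * clamped_angle (b\<^sup>2) (c\<^sup>2) (a\<^sup>2) +
        w $ k * clamped_angle (c\<^sup>2) (a\<^sup>2) (b\<^sup>2) \<in> (\<lambda>i. w $ i * pi) ` {i, j, k}"
      using degenerate_clamped_angles[of c a b] degenerate_clamped_angles[of c b a] pos
      by (simp add: clamped_angle_commute[of "a\<^sup>2" "b\<^sup>2"] add.commute)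
  qed
qed

definition angle_deriv :: "real^'v \<Rightarrow> 'v \<Rightarrow> 'v \<Rightarrow> 'v \<Rightarrow> real^'v \<Rightarrow> real" where
  "angle_deriv u i j k v =
    (let A = sq_length I u j k; B = sq_length I u k i; C = sq_length I u i j;
         a = foot I u j k * v $ j + (1 - foot I u j k) * v $ k;
         b = foot I u k i * v $ k + (1 - foot I u k i) * v $ i;
         c = foot I u i j * v $ i + (1 - foot I u i j) * v $ j
     in (2 * A * a - (A + B - C) * b - (A + C - B) * c) / sqrt (heron A B C))"

lemma has_derivative_face_angle:
  assumes "{i, j, k} \<in> F" "nondegenerate I u {i, j, k}"
  shows "((\<lambda>u. face_angle I u i j k) has_derivative angle_deriv u i j k) (at u)"
  unfolding face_angle_def angle_deriv_def Let_def
  using sq_lengths_pos[OF assms(1)] assms(2) face_weights[OF assms(1)]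
  by (intro has_derivative_clamped_angle has_derivative_sq_length) (auto simp: nondegenerate_iff[OF assms(1)])

text \<open>The squared lengths and feet satisfy Carnot's condition because \<open>A (2 q - 1)\<close> is the
  difference of the squared radii at the ends of the edge, and these differences cancel around
  the face.\<close>

lemma has_derivative_angle_at:
  assumes "f \<in> F" "nondegenerate I u f"
  obtains D where "\<And>i. i \<in> f \<Longrightarrow> ((\<lambda>u. angle_at I f u i) has_derivative D i) (at u)"
    and "\<And>w. (\<Sum>i\<in>f. w $ i * D i w) \<le> 0"
    and "\<And>w m n. (\<Sum>i\<in>f. w $ i * D i w) = 0 \<Longrightarrow> m \<in> f \<Longrightarrow> n \<in> f \<Longrightarrow> w $ m = w $ n"
proof -
  from face_cases[OF assms(1)] obtain i j k where f: "f = {i, j, k}" "{i, j, k} \<in> F"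
    and dist: "i \<noteq> j" "j \<noteq> k" "k \<noteq> i" by metis
  have p: "{i, j, k} = {j, k, i}" "{i, j, k} = {k, i, j}" by auto
  have f': "{j, k, i} \<in> F" "{k, i, j} \<in> F" using f(2) p by metis+
  have nd: "nondegenerate I u {i, j, k}" "nondegenerate I u {j, k, i}" "nondegenerate I u {k, i, j}"
    using assms(2) f(1) p by metis+
  define D where "D m = (if m = i then angle_deriv u i j k
     else if m = j then angle_deriv u j k i else angle_deriv u k i j)" for m
  have Dv: "D i = angle_deriv u i j k" "D j = angle_deriv u j k i" "D k = angle_deriv u k i j"
    using dist by (auto simp: D_def)
  define A B C where "A = sq_length I u j k" and "B = sq_length I u k i" and "C = sq_length I u i j"
  have pos: "0 < A" "0 < B" "0 < C" unfolding A_def B_def C_def using sq_lengths_pos[OF f(2)] by auto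
  have H: "0 < heron A B C" using nd(1) by (simp add: nondegenerate_iff[OF f(2)] A_def B_def C_def)
  note wt = face_weights[OF f(2)]
  have e: "A * (2 * foot I u j k - 1) + B * (2 * foot I u k i - 1) + C * (2 * foot I u i j - 1) = 0"
    unfolding A_def B_def C_def sq_length_times_foot(3)[of I i j, OF wt(1)]
      sq_length_times_foot(3)[of I j k, OF wt(2)] sq_length_times_foot(3)[of I k i, OF wt(3)] by simp
  note form = angle_variation_negative[OF pos H e foot_bounds[of I i j u, OF wt(1)] foot_bounds[of I j k u, OF wt(2)]
      foot_bounds[of I k i u, OF wt(3)]]
  have sum_eq: "(\<Sum>m\<in>f. w $ m * D m w) =
      (let x = w $ i; y = w $ j; z = w $ k;
        a = foot I u j k * y + (1 - foot I u j k) * z;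
        b = foot I u k i * z + (1 - foot I u k i) * x;
        c = foot I u i j * x + (1 - foot I u i j) * y in
      (x * (2*A*a - (A + B - C) * b - (A + C - B) * c)
     + y * (2*B*b - (B + C - A) * c - (B + A - C) * a)
     + z * (2*C*c - (C + A - B) * a - (C + B - A) * b)) / sqrt (heron A B C))" for w
    unfolding f(1) sum_face[OF f(2)] Dv angle_deriv_def Let_def
      A_def[symmetric] B_def[symmetric] C_def[symmetric]
    by (simp add: heron_commute add_divide_distrib)
  show ?thesis
  proof (rule that)
    fix m assume "m \<in> f"
    thus "((\<lambda>u. angle_at I f u m) has_derivative D m) (at u)"
      unfolding f(1) using has_derivative_face_angle[OF f(2) nd(1)]
        has_derivative_face_angle[OF f'(1) nd(2)] has_derivative_face_angle[OF f'(2) nd(3)]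
      by (auto simp: angles_at[OF f(2)] Dv)
  next
    fix w
    show "(\<Sum>m\<in>f. w $ m * D m w) \<le> 0"
      unfolding sum_eq Let_def using H form(1) by (intro divide_nonpos_pos) auto
  next
    fix w m n assume *: "(\<Sum>m\<in>f. w $ m * D m w) = 0" and mn: "m \<in> f" "n \<in> f"
    have "sqrt (heron A B C) \<noteq> 0" using H by simp
    hence "w $ i = w $ j \<and> w $ j = w $ k"
      using * form(2)[of "w $ i" "w $ j" "w $ k"] unfolding sum_eq Let_def
      by (simp only: divide_eq_0_iff simp_thms)
    thus "w $ m = w $ n" using mn unfolding f(1) by auto
  qed
qed

text \<open>On the segment from \<open>v\<close> to \<open>u\<close> the weighted angle sum has nonpositive derivative unless
  it takes one of the values that are possible on degenerate faces.\<close>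

lemma angle_at_monotone:
  assumes f: "f \<in> F"
  shows "(\<Sum>i\<in>f. (u - v) $ i * angle_at I f u i) \<le> (\<Sum>i\<in>f. (u - v) $ i * angle_at I f v i)"
proof -
  define w where "w = u - v"
  define \<phi> where "\<phi> = (\<lambda>s. \<Sum>i\<in>f. w $ i * angle_at I f (v + s *\<^sub>R w) i)"
  have "\<phi> 1 \<le> \<phi> 0"
  proof (rule nonincreasing_off_finite_values[where f = \<phi> and S = "(\<lambda>i. w $ i * pi) ` f"])
    show "finite ((\<lambda>i. w $ i * pi) ` f)" by simp
    show "continuous_on {0..1} \<phi>" unfolding \<phi>_def
      by (intro continuous_intros continuous_on_compose2[OF continuous_on_angle_at[OF f, of _ UNIV]]) auto
    fix s assume "\<phi> s \<notin> (\<lambda>i. w $ i * pi) ` f"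
    hence nd: "nondegenerate I (v + s *\<^sub>R w) f"
      using degenerate_angles[OF f] unfolding \<phi>_def by blast
    obtain D where D: "\<And>i. i \<in> f \<Longrightarrow> ((\<lambda>u. angle_at I f u i) has_derivative D i) (at (v + s *\<^sub>R w))"
      and neg: "\<And>w. (\<Sum>i\<in>f. w $ i * D i w) \<le> 0"
      using has_derivative_angle_at[OF f nd] by metis
    have line: "((\<lambda>s. v + s *\<^sub>R w) has_derivative (\<lambda>h. h *\<^sub>R w)) (at s)"
      by (auto intro!: derivative_eq_intros)
    have "((\<lambda>s. angle_at I f (v + s *\<^sub>R w) i) has_real_derivative D i w) (at s)" if "i \<in> f" for i
      unfolding has_field_derivative_def
      by (rule has_derivative_eq_rhs[OF has_derivative_compose[OF line D[OF that]]])
        (simp add: fun_eq_iff linear_cmul[OF has_derivative_linear[OF D[OF that]]])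
    hence "(\<phi> has_real_derivative (\<Sum>i\<in>f. w $ i * D i w)) (at s)"
      unfolding \<phi>_def by (intro DERIV_sum DERIV_cmult)
    thus "\<exists>d\<le>0. (\<phi> has_real_derivative d) (at s)" using neg by blast
  qed simp
  thus ?thesis by (simp add: \<phi>_def w_def)
qed

end

section \<open>The curvature field\<close>

lemma has_vector_derivative_vec_iff:
  fixes u :: "real \<Rightarrow> real^'n"
  shows "(u has_vector_derivative x) (at t within S) \<longleftrightarrow>
    (\<forall>i. ((\<lambda>s. u s $ i) has_real_derivative x $ i) (at t within S))"
proof -
  have eq: "(\<lambda>h. h * x $ i) = (*) (x $ i)" for i by (simp add: fun_eq_iff)
  show ?thesis
    unfolding has_vector_derivative_def has_field_derivative_def
    by (subst has_derivative_componentwise_within)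
      (auto simp: Basis_vec_def inner_axis eq)
qed

lemma has_derivative_vec_lambda:
  fixes f :: "'a::euclidean_space \<Rightarrow> 'n::finite \<Rightarrow> real"
  assumes "\<And>i. ((\<lambda>x. f x i) has_derivative (\<lambda>v. f' v i)) (at a)"
  shows "((\<lambda>x. \<chi> i. f x i) has_derivative (\<lambda>v. \<chi> i. f' v i)) (at a)"
  by (subst has_derivative_componentwise_within) (use assms in \<open>auto simp: Basis_vec_def inner_axis\<close>)

lemma clamped_angle_scale:
  assumes "0 < k"
  shows "clamped_angle (k * A) (k * B) (k * C) = clamped_angle A B C"
proof -
  have "sqrt (k * B * (k * C)) = k * sqrt (B * C)"
    using assms by (simp add: real_sqrt_mult)
  moreover have "(k * B + k * C - k * A) / (2 * (k * sqrt (B * C))) = (B + C - A) / (2 * sqrt (B * C))"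
    using assms by (simp flip: distrib_left right_diff_distrib)
  ultimately show ?thesis by (simp add: clamped_angle_def mult.assoc)
qed

lemma heron_scale: "heron (k * A) (k * B) (k * C) = k\<^sup>2 * heron A B C"
  by (simp add: heron_def power2_eq_square algebra_simps)

lemma sq_length_shift:
  "sq_length I (u + (\<chi> i. c)) i j = (exp c)\<^sup>2 * sq_length I u i j"
  by (simp add: sq_length_def exp_add power2_eq_square algebra_simps)

context weighted_faces
begin

lemma angle_at_shift:
  assumes "f \<in> F" "i \<in> f"
  shows "angle_at I f (u + (\<chi> i. c)) i = angle_at I f u i"
proof -
  from face_cases[OF assms(1)] obtain a b c where f: "f = {a, b, c}" "{a, b, c} \<in> F" by metis
  show ?thesis using assms(2) angles_at[OF f(2)]
    unfolding f(1) by (auto simp: face_angle_def sq_length_shift clamped_angle_scale)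
qed

lemma nondegenerate_shift: "nondegenerate I (u + (\<chi> i. c)) f \<longleftrightarrow> nondegenerate I u f"
  by (simp add: nondegenerate_def sq_length_shift heron_scale zero_less_mult_iff)

lemma strict_triangle_edges_iff:
  assumes "{i, j, k} \<in> F"
  shows "strict_triangle (edge_length I (exp_vec u) i j) (edge_length I (exp_vec u) j k)
      (edge_length I (exp_vec u) i k) \<longleftrightarrow> nondegenerate I u {i, j, k}"
proof -
  have "strict_triangle (sqrt (sq_length I u j k)) (sqrt (sq_length I u k i)) (sqrt (sq_length I u i j))
     \<longleftrightarrow> nondegenerate I u {i, j, k}"
    using heron_pos_iff_strict_triangle[of "sqrt (sq_length I u j k)" "sqrt (sq_length I u k i)"
        "sqrt (sq_length I u i j)"] sq_lengths_pos[OF assms, of u]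
    by (simp add: nondegenerate_iff[OF assms])
  thus ?thesis
    by (auto simp: edge_length_exp_vec strict_triangle_def sq_length_commute[of I u i k])
qed

lemma exp_vec_in_Omega_iff: "exp_vec u \<in> Omega F I \<longleftrightarrow> (\<forall>f\<in>F. nondegenerate I u f)"
proof
  assume *: "exp_vec u \<in> Omega F I"
  show "\<forall>f\<in>F. nondegenerate I u f"
  proof
    fix f assume "f \<in> F"
    from face_cases[OF this] obtain i j k where f: "f = {i, j, k}" "{i, j, k} \<in> F" by metis
    have "strict_triangle (edge_length I (exp_vec u) i j) (edge_length I (exp_vec u) j k)
        (edge_length I (exp_vec u) i k)"
      using * f(2) by (simp add: Omega_def)
    thus "nondegenerate I u f" unfolding f(1) strict_triangle_edges_iff[OF f(2)] .
  qed
next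
  assume *: "\<forall>f\<in>F. nondegenerate I u f"
  have "0 < exp_vec u $ i" for i by (simp add: exp_vec_def)
  thus "exp_vec u \<in> Omega F I" using * strict_triangle_edges_iff by (simp add: Omega_def)
qed

lemma curvature_eq_ext_curvature:
  assumes "r \<in> Omega F I"
  shows "curvature F I r i = ext_curvature F I r i"
proof -
  have "angle_in_face (theta I r) i f = angle_in_face (gen_theta I r) i f" if "f \<in> F" for f
  proof -
    have eq: "theta I r i j k = gen_theta I r i j k" if "f = {i, j, k}" for j k
    proof -
      have "strict_triangle (edge_length I r i j) (edge_length I r j k) (edge_length I r i k)"
        using assms \<open>f \<in> F\<close> that by (simp add: Omega_def)
      thus ?thesis by (simp add: gen_theta_def strict_triangle_def add.commute)
    qed
    have "(\<exists>j k. f = {i, j, k} \<and> \<alpha> = theta I r i j k) \<longleftrightarrow> (\<exists>j k. f = {i, j, k} \<and> \<alpha> = gen_theta I r i j k)" for \<alpha>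
      using eq by metis
    thus ?thesis by (simp add: angle_in_face_def)
  qed
  thus ?thesis unfolding curvature_def ext_curvature_def by (intro arg_cong2[where f = "(-)"] sum.cong) auto
qed

text \<open>With \<open>k\<close> equal to the average curvature this is the right-hand side of the extended flow
  in logarithmic coordinates.\<close>

definition curvature_field :: "real \<Rightarrow> real^'v \<Rightarrow> real^'v" where
  "curvature_field k u = (\<chi> i. k - ext_curvature F I (exp_vec u) i)"

lemma curvature_field_nth:
  "curvature_field k u $ i = k - 2 * pi + (\<Sum>f | f \<in> F \<and> i \<in> f. angle_at I f u i)"
  by (simp add: curvature_field_def ext_curvature_def angle_at_def)

lemma sum_vertices_faces:
  "(\<Sum>i\<in>UNIV. (\<Sum>f | f \<in> F \<and> i \<in> f. g f i)) = (\<Sum>f\<in>F. \<Sum>i\<in>f. (g f i :: real))"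
proof -
  have "(\<Sum>i\<in>UNIV. (\<Sum>f | f \<in> F \<and> i \<in> f. g f i)) = (\<Sum>i\<in>UNIV. \<Sum>f\<in>F. if i \<in> f then g f i else 0)"
    by (intro sum.cong refl sum.inter_filter) simp
  also have "\<dots> = (\<Sum>f\<in>F. \<Sum>i\<in>UNIV. if i \<in> f then g f i else 0)" by (rule sum.swap)
  also have "\<dots> = (\<Sum>f\<in>F. \<Sum>i\<in>f. g f i)"
    by (rule sum.cong[OF refl]) (simp add: sum.If_cases)
  finally show ?thesis .
qed

lemma curvature_field_inner:
  "curvature_field k u \<bullet> w = (k - 2 * pi) * (\<Sum>i\<in>UNIV. w $ i)
     + (\<Sum>f\<in>F. \<Sum>i\<in>f. w $ i * angle_at I f u i)"
proof -
  have "curvature_field k u \<bullet> w = (\<Sum>i\<in>UNIV. (k - 2 * pi) * w $ i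
      + (\<Sum>f | f \<in> F \<and> i \<in> f. w $ i * angle_at I f u i))"
    by (simp add: inner_vec_def curvature_field_nth distrib_left sum_distrib_left mult.commute)
  thus ?thesis by (simp add: sum.distrib sum_vertices_faces sum_distrib_left)
qed

lemma curvature_field_dissipative:
  "(curvature_field k u - curvature_field k v) \<bullet> (u - v) \<le> 0"
proof -
  have "(\<Sum>f\<in>F. \<Sum>i\<in>f. (u - v) $ i * angle_at I f u i)
      \<le> (\<Sum>f\<in>F. \<Sum>i\<in>f. (u - v) $ i * angle_at I f v i)"
    by (intro sum_mono angle_at_monotone)
  thus ?thesis unfolding inner_diff_left curvature_field_inner by linarith
qed

lemma continuous_on_curvature_field: "continuous_on UNIV (curvature_field k)"
proof -
  have "continuous_on UNIV (\<lambda>u. curvature_field k u $ i)" for i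
    unfolding curvature_field_nth by (intro continuous_intros continuous_on_angle_at) auto
  from continuous_on_vec_lambda[of UNIV "\<lambda>i u. curvature_field k u $ i", OF this]
  show ?thesis by simp
qed

lemma curvature_field_bounded:
  "norm (curvature_field k u) \<le> real CARD('v) * (\<bar>k - 2 * pi\<bar> + real (card F) * pi)"
proof -
  have "\<bar>curvature_field k u $ i\<bar> \<le> \<bar>k - 2 * pi\<bar> + real (card F) * pi" for i
  proof -
    have "\<bar>\<Sum>f | f \<in> F \<and> i \<in> f. angle_at I f u i\<bar> \<le> (\<Sum>f | f \<in> F \<and> i \<in> f. \<bar>angle_at I f u i\<bar>)"
      by (rule sum_abs)
    also have "\<dots> \<le> (\<Sum>f | f \<in> F \<and> i \<in> f. pi)"
      using angle_at_bounds by (intro sum_mono) auto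
    also have "\<dots> \<le> (\<Sum>f\<in>F. pi)" by (intro sum_mono2) auto
    finally show ?thesis unfolding curvature_field_nth by simp
  qed
  hence "(\<Sum>i\<in>UNIV. \<bar>curvature_field k u $ i\<bar>) \<le> (\<Sum>i\<in>(UNIV::'v set). \<bar>k - 2 * pi\<bar> + real (card F) * pi)"
    by (intro sum_mono)
  thus ?thesis using norm_le_l1_cart[of "curvature_field k u"] by simp
qed

lemma curvature_field_shift: "curvature_field k (u + (\<chi> i. c)) = curvature_field k u"
  by (simp add: vec_eq_iff curvature_field_nth angle_at_shift)

text \<open>A Gauss--Bonnet formula: every face contributes the angle sum \<open>\<pi>\<close>, so the total is
  independent of \<open>u\<close>.\<close>

lemma curvature_field_total:
  "curvature_field k u \<bullet> (\<chi> i. 1) = (k - 2 * pi) * CARD('v) + real (card F) * pi"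
  unfolding curvature_field_inner by (simp add: angle_at_sum)

text \<open>A null vector of the form has equal components on every face, hence is constant when the
  faces connect all vertices, hence is 0 on the hyperplane.\<close>

lemma curvature_field_derivative_negative:
  assumes nd: "\<And>f. f \<in> F \<Longrightarrow> nondegenerate I p f"
    and conn: "\<And>(w :: 'v \<Rightarrow> real) m n.
      (\<And>f m n. f \<in> F \<Longrightarrow> m \<in> f \<Longrightarrow> n \<in> f \<Longrightarrow> w m = w n) \<Longrightarrow> w m = w n"
  obtains D where "(curvature_field k has_derivative D) (at p)"
    and "\<And>w. w \<bullet> (\<chi> i. 1) = 0 \<Longrightarrow> w \<noteq> 0 \<Longrightarrow> D w \<bullet> w < 0"
proof -
  define good where "good f D \<longleftrightarrow> (\<forall>i\<in>f. ((\<lambda>u. angle_at I f u i) has_derivative D i) (at p)) \<and>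
      (\<forall>w. (\<Sum>i\<in>f. w $ i * D i w) \<le> 0) \<and>
      (\<forall>w m n. (\<Sum>i\<in>f. w $ i * D i w) = 0 \<longrightarrow> m \<in> f \<longrightarrow> n \<in> f \<longrightarrow> w $ m = w $ n)" for f D
  have "\<exists>D. good f D" if f: "f \<in> F" for f
    unfolding good_def by (rule has_derivative_angle_at[OF f nd[OF f]]) blast
  then obtain d where good: "\<And>f. f \<in> F \<Longrightarrow> good f (d f)" by metis
  have d: "((\<lambda>u. angle_at I f u i) has_derivative d f i) (at p)" if "f \<in> F" "i \<in> f" for f i
    using good[OF that(1)] that(2) unfolding good_def by blast
  have nonpos: "(\<Sum>i\<in>f. w $ i * d f i w) \<le> 0" if "f \<in> F" for f w
    using good[OF that] unfolding good_def by blast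
  have const_on_face: "w $ m = w $ n"
    if "f \<in> F" "(\<Sum>i\<in>f. w $ i * d f i w) = 0" "m \<in> f" "n \<in> f" for f w m n
    using good[OF that(1)] that unfolding good_def by blast
  define D where "D w = (\<chi> i. \<Sum>f | f \<in> F \<and> i \<in> f. d f i w)" for w
  have "((\<lambda>u. \<chi> i. k - 2 * pi + (\<Sum>f | f \<in> F \<and> i \<in> f. angle_at I f u i)) has_derivative D) (at p)"
    unfolding D_def
  proof (rule has_derivative_vec_lambda)
    fix i
    have "((\<lambda>u. k - 2 * pi + (\<Sum>f | f \<in> F \<and> i \<in> f. angle_at I f u i)) has_derivative
        (\<lambda>v. 0 + (\<Sum>f | f \<in> F \<and> i \<in> f. d f i v))) (at p)"
      by (intro has_derivative_add has_derivative_const has_derivative_sum d) auto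
    thus "((\<lambda>u. k - 2 * pi + (\<Sum>f | f \<in> F \<and> i \<in> f. angle_at I f u i)) has_derivative
        (\<lambda>v. \<Sum>f | f \<in> F \<and> i \<in> f. d f i v)) (at p)" by simp
  qed
  moreover have "curvature_field k = (\<lambda>u. \<chi> i. k - 2 * pi + (\<Sum>f | f \<in> F \<and> i \<in> f. angle_at I f u i))"
    by (simp add: fun_eq_iff vec_eq_iff curvature_field_nth)
  ultimately have deriv: "(curvature_field k has_derivative D) (at p)" by simp
  have "D w \<bullet> w < 0" if w: "w \<bullet> (\<chi> i. 1) = 0" "w \<noteq> 0" for w
  proof -
    have "D w \<bullet> w = (\<Sum>i\<in>UNIV. (\<Sum>f | f \<in> F \<and> i \<in> f. w $ i * d f i w))"
      by (simp add: D_def inner_vec_def sum_distrib_left mult.commute)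
    hence Dw: "D w \<bullet> w = (\<Sum>f\<in>F. \<Sum>i\<in>f. w $ i * d f i w)" by (simp add: sum_vertices_faces)
    have "D w \<bullet> w \<le> 0" unfolding Dw by (intro sum_nonpos nonpos)
    moreover have "D w \<bullet> w \<noteq> 0"
    proof
      assume "D w \<bullet> w = 0"
      hence "(\<Sum>f\<in>F. - (\<Sum>i\<in>f. w $ i * d f i w)) = 0" unfolding Dw by (simp add: sum_negf)
      hence z: "\<And>f. f \<in> F \<Longrightarrow> - (\<Sum>i\<in>f. w $ i * d f i w) = 0"
        using nonpos by (subst (asm) sum_nonneg_eq_0_iff) auto
      have const: "w $ m = w $ n" for m n
        by (rule conn[of "\<lambda>i. w $ i"]) (rule const_on_face, use z in auto)
      have "w $ m = 0" for m
      proof -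
        have "0 = (\<Sum>i\<in>(UNIV::'v set). w $ i)" using w(1) by (simp add: inner_vec_def)
        also have "\<dots> = (\<Sum>i\<in>(UNIV::'v set). w $ m)" by (intro sum.cong refl const)
        finally show ?thesis by simp
      qed
      thus False using w(2) by (simp add: vec_eq_iff)
    qed
    ultimately show ?thesis by simp
  qed
  with deriv show ?thesis by (rule that)
qed

lemma extended_flow_iff:
  "extended_flow E F I u \<longleftrightarrow>
    (\<forall>t\<ge>0. (u has_vector_derivative curvature_field (K_av E F) (u t)) (at t within {0..}))"
  by (simp add: extended_flow_def has_vector_derivative_vec_iff curvature_field_def)

lemma constant_curvature_exp_vec_iff:
  "constant_curvature E F I (exp_vec u) \<longleftrightarrow>
    (\<forall>f\<in>F. nondegenerate I u f) \<and> curvature_field (K_av E F) u = 0"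
  unfolding constant_curvature_def exp_vec_in_Omega_iff[symmetric]
  by (auto simp: curvature_field_def vec_eq_iff curvature_eq_ext_curvature)

lemma exp_vec_ln:
  assumes "r \<in> Omega F I"
  shows "exp_vec (\<chi> i. ln (r $ i)) = r"
  using assms by (simp add: exp_vec_def Omega_def vec_eq_iff)

lemma extended_flow_exists:
  "\<exists>u. extended_flow E F I u \<and> u 0 = u0"
  using dissipative_flow_exists[OF continuous_on_curvature_field curvature_field_dissipative
      curvature_field_bounded, of u0 "K_av E F"]
  unfolding extended_flow_iff by blast

text \<open>While the normalized flow exists it stays in the region where both curvatures agree, so
  its logarithm solves the extended flow, whose solutions are unique.\<close>

lemma extended_flow_extends_normalized_flow:
  assumes J: "is_interval J" "0 \<in> J" "J \<subseteq> {0..}" and r: "normalized_flow E F I J r"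
    and u: "extended_flow E F I u" "exp_vec (u 0) = r 0" and T: "T \<in> J"
  shows "exp_vec (u T) = r T"
proof -
  define v where "v = (\<lambda>t. \<chi> i. ln (r t $ i))"
  have "0 \<le> T" using T J(3) by auto
  have sub: "{0..T} \<subseteq> J"
    using J(1,2) T by (auto intro: mem_is_interval_1_I[of J 0 T])
  have Om: "r t \<in> Omega F I" if "t \<in> J" for t using r that by (simp add: normalized_flow_def)
  have ev: "exp_vec (v t) = r t" if "t \<in> J" for t using exp_vec_ln[OF Om[OF that]] by (simp add: v_def)
  have "u T = v T"
  proof (rule dissipative_flow_unique[OF curvature_field_dissipative \<open>0 \<le> T\<close>])
    fix t assume t: "t \<in> {0..T}"
    show "(u has_vector_derivative curvature_field (K_av E F) (u t)) (at t within {0..T})"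
      by (rule has_vector_derivative_within_subset[of _ _ _ "{0..}"])
        (use u(1) t in \<open>auto simp: extended_flow_iff\<close>)
    have tJ: "t \<in> J" using sub t by blast
    have "((\<lambda>s. v s $ i) has_real_derivative curvature_field (K_av E F) (v t) $ i) (at t within {0..T})" for i
    proof -
      have pos: "0 < r t $ i" using Om[OF tJ] by (simp add: Omega_def)
      have "((\<lambda>s. r s $ i) has_real_derivative (K_av E F - curvature F I (r t) i) * r t $ i) (at t within {0..T})"
        by (rule has_field_derivative_subset[OF _ sub]) (use r tJ in \<open>simp add: normalized_flow_def\<close>)
      from DERIV_chain2[OF DERIV_ln_divide[OF pos] this]
      have "((\<lambda>s. ln (r s $ i)) has_real_derivative K_av E F - curvature F I (r t) i) (at t within {0..T})"
        using pos by simp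
      thus ?thesis by (simp add: v_def[symmetric] curvature_field_def ev[OF tJ] curvature_eq_ext_curvature[OF Om[OF tJ]])
        (simp add: v_def)
    qed
    thus "(v has_vector_derivative curvature_field (K_av E F) (v t)) (at t within {0..T})"
      by (simp add: has_vector_derivative_vec_iff)
  next
    have "exp_vec (u 0) = exp_vec (v 0)" using u(2) ev[OF J(2)] by simp
    thus "u 0 = v 0" by (simp add: exp_vec_def vec_eq_iff)
  qed
  thus ?thesis using ev[OF T] by simp
qed

text \<open>The limit is the given metric of constant curvature, scaled so that the product of its
  radii equals that of the initial metric.\<close>

lemma extended_flow_converges:
  assumes conn: "\<And>(w :: 'v \<Rightarrow> real) m n.
      (\<And>f m n. f \<in> F \<Longrightarrow> m \<in> f \<Longrightarrow> n \<in> f \<Longrightarrow> w m = w n) \<Longrightarrow> w m = w n"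
    and r: "constant_curvature E F I r" and u: "extended_flow E F I u"
  shows "\<exists>u'. constant_curvature E F I (exp_vec u') \<and> converges_exponentially u u'"
proof -
  let ?K = "curvature_field (K_av E F)" and ?one = "(\<chi> i. 1) :: real^'v"
  have "r \<in> Omega F I" using r by (simp add: constant_curvature_def)
  then obtain p0 where p0: "exp_vec p0 = r" using exp_vec_ln by metis
  define c where "c = ((u 0 - p0) \<bullet> ?one) / CARD('v)"
  define p where "p = p0 + (\<chi> i. c)"
  have p: "\<forall>f\<in>F. nondegenerate I p f" "?K p = 0"
    using r unfolding p0[symmetric] constant_curvature_exp_vec_iff p_def nondegenerate_shift curvature_field_shift
    by auto
  obtain D where D: "(?K has_derivative D) (at p)"
    and neg: "\<And>w. w \<bullet> ?one = 0 \<Longrightarrow> w \<noteq> 0 \<Longrightarrow> D w \<bullet> w < 0"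
    using curvature_field_derivative_negative[OF _ conn, of p "K_av E F"] p(1) by metis
  have "(\<chi> i. c) \<bullet> ?one = c * CARD('v)" by (simp add: inner_vec_def)
  hence start: "(u 0 - p) \<bullet> ?one = 0" by (simp add: p_def c_def inner_diff_left inner_add_left)
  have total: "?K v \<bullet> ?one = 0" for v
    using curvature_field_total[of "K_av E F" v] curvature_field_total[of "K_av E F" p] p(2) by simp
  have "\<exists>C>0. \<exists>c>0. \<forall>t\<ge>0. norm (u t - p) \<le> C * exp (- c * t)"
    by (rule dissipative_flow_converges[where u = u, OF curvature_field_dissipative p(2) D neg total start])
      (use u in \<open>auto simp: extended_flow_iff\<close>)
  moreover have "constant_curvature E F I (exp_vec p)" using p by (simp add: constant_curvature_exp_vec_iff)
  ultimately show ?thesis unfolding converges_exponentially_def by blast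
qed

end


section \<open>Connectedness of the one-skeleton\<close>

text \<open>If \<open>w\<close> is constant on each face, then the barycentric coordinates of a point that belong
  to vertices with the value \<open>w m\<close> sum up to 0 or 1. This sum is continuous on the connected
  realization, hence constant, and comparing it at two vertices shows that they have the same
  value.\<close>

lemma faces_connect_vertices:
  fixes w :: "'v::finite \<Rightarrow> real"
  assumes tri: "surface_triangulation M E F" and conn: "connected_space M"
    and w: "\<And>f m n. f \<in> F \<Longrightarrow> m \<in> f \<Longrightarrow> n \<in> f \<Longrightarrow> w m = w n"
  shows "w m = w n"
proof -
  define S where "S = geometric_realization E F"
  define A where "A = {i. w i = w m}"
  define g where "g = (\<lambda>x :: real^'v. \<Sum>i\<in>A. x $ i)"
  have hom: "M homeomorphic_space top_of_set S" and edge_in_face: "\<forall>e\<in>E. \<exists>f\<in>F. e \<subseteq> f"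
    using tri by (simp_all add: surface_triangulation_def S_def)
  from homeomorphic_connected_space[OF hom] conn have S: "connected S"
    using connectedin_iff_connected[of S] by (simp add: connectedin_def)
  have g_cont: "continuous_on S g" unfolding g_def by (intro continuous_intros)
  have support_const: "w i = w j" if "s \<in> range (\<lambda>i. {i}) \<union> E \<union> F" "i \<in> s" "j \<in> s" for s i j
  proof -
    consider "s \<in> range (\<lambda>i. {i})" | "s \<in> E" | "s \<in> F" using \<open>s \<in> _\<close> by blast
    thus ?thesis
    proof cases
      case 2
      then obtain f where "f \<in> F" "s \<subseteq> f" using edge_in_face by blast
      thus ?thesis using w \<open>i \<in> s\<close> \<open>j \<in> s\<close> by blast
    next
      case 1
      thus ?thesis using \<open>i \<in> s\<close> \<open>j \<in> s\<close> by auto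
    next
      case 3
      thus ?thesis using \<open>i \<in> s\<close> \<open>j \<in> s\<close> by (rule w)
    qed
  qed
  have "g x \<in> {0, 1}" if "x \<in> S" for x
  proof -
    let ?s = "{i. x $ i \<noteq> 0}"
    have s: "?s \<in> range (\<lambda>i. {i}) \<union> E \<union> F" and sum1: "(\<Sum>i\<in>UNIV. x $ i) = 1"
      using that unfolding S_def geometric_realization_def by auto
    show ?thesis
    proof (cases "?s \<inter> A = {}")
      case True
      hence "g x = 0" unfolding g_def by (intro sum.neutral) auto
      thus ?thesis by simp
    next
      case False
      then obtain j where j: "j \<in> ?s" "w j = w m" by (auto simp: A_def)
      have "i \<in> A" if "i \<in> ?s" for i using support_const[OF s that j(1)] j(2) by (simp add: A_def)
      hence "(\<Sum>i\<in>A. x $ i) = (\<Sum>i\<in>UNIV. x $ i)"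
        by (intro sum.mono_neutral_left) auto
      thus ?thesis using sum1 by (simp add: g_def)
    qed
  qed
  hence "finite (g ` S)" by (intro finite_subset[of "g ` S" "{0, 1}"]) auto
  then obtain a where a: "\<And>x. x \<in> S \<Longrightarrow> g x = a"
    using continuous_finite_range_constant[OF S g_cont] by (auto simp: constant_on_def)
  have vertex: "axis i 1 \<in> S" for i
    by (auto simp: S_def geometric_realization_def axis_def if_distrib cong: if_cong)
  have g_vertex: "g (axis i 1) = (if i \<in> A then 1 else 0)" for i
    by (simp add: g_def axis_def)
  have "g (axis m 1) = g (axis n 1)" using a vertex by metis
  thus ?thesis unfolding g_vertex by (auto simp: A_def split: if_splits)
qed


section \<open>Convergence of the extended flow\<close>

theorem theorem2p3:
  fixes M :: "'a topology" and E F :: "'v::finite set set" and I :: "'v set \<Rightarrow> real"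
  assumes "closed_surface M" and "connected_space M"
    and "surface_triangulation M E F"
    and "\<forall>e\<in>E. 0 \<le> I e"
    and "\<exists>r. constant_curvature E F I r"
  shows
    "(\<forall>J r. is_interval J \<and> 0 \<in> J \<and> J \<subseteq> {0..} \<and> normalized_flow E F I J r \<longrightarrow>
        (\<exists>u. extended_flow E F I u \<and> (\<forall>t\<in>J. exp_vec (u t) = r t) \<and>
             (\<exists>u'. constant_curvature E F I (exp_vec u') \<and> converges_exponentially u u'))) \<and>
     (\<forall>u0\<in>ln_Omega F I. \<exists>u. extended_flow E F I u \<and> u 0 = u0) \<and>
     (\<forall>u. extended_flow E F I u \<and> u 0 \<in> ln_Omega F I \<longrightarrow>
        (\<exists>u'. constant_curvature E F I (exp_vec u') \<and> converges_exponentially u u'))"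
proof -
  interpret weighted_faces F I
    using assms(3,4) unfolding surface_triangulation_def by unfold_locales blast+
  have conv: "\<exists>u'. constant_curvature E F I (exp_vec u') \<and> converges_exponentially u u'"
    if "extended_flow E F I u" for u
    using extended_flow_converges[OF faces_connect_vertices[OF assms(3,2)]] assms(5) that by blast
  have ext: "\<exists>u. extended_flow E F I u \<and> (\<forall>t\<in>J. exp_vec (u t) = r t)"
    if J: "is_interval J" "0 \<in> J" "J \<subseteq> {0..}" and r: "normalized_flow E F I J r" for J r
  proof -
    have "r 0 \<in> Omega F I" using r J(2) by (simp add: normalized_flow_def)
    then obtain u0 where "exp_vec u0 = r 0" using exp_vec_ln by metis
    moreover obtain u where "extended_flow E F I u" "u 0 = u0" using extended_flow_exists by blast
    ultimately show ?thesis using extended_flow_extends_normalized_flow[OF J r] by metis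
  qed
  show ?thesis
    using conv ext extended_flow_exists by (intro conjI allI impI ballI; meson)
qed

end
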